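(* Let $\Gamma$ be a strongly regular graph. Then $A_{\Gamma}$ has the $R_\infty$-property.
   Context: A graph is a finite simple non-empty graph $\Gamma(V,E)$. For $v\in V$, $lk(v)$ is the set of vertices adjacent to $v$. A graph is $k$-regular if every vertex has degree $k$. A graph $\Gamma$ is strongly regular (with parameters $n,k,\lambda,\mu$) if it is a $k$-regular graph on $n$ vertices such that: if $vw\in E$ then $|lk(v)\cap lk(w)|=\lambda$; if $vw\notin E$ and $v\neq w$ then $|lk(v)\cap lk(w)|=\mu$; and $1\le k<n-1$. The right-angled Artin group associated to $\Gamma$ is $A_\Gamma=\langle V \mid [v,w],\ vw\in E\rangle$. For a group $G$ and $\varphi\in\operatorname{Aut}(G)$, elements $x,y\in G$ are $\varphi$-conjugate if $x=gy\varphi(g)^{-1}$ for some $g\in G$; the Reidemeister number $R(\varphi)$ is the number of $\varphi$-conjugacy classes ($\infty$ if there are infinitely many). $G$ has the $R_\infty$-property if $R(\varphi)=\infty$ for all $\varphi\in\operatorname{Aut}(G)$. *)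

theory Defs
  imports
    "HOL-Algebra.Bij"
    "HOL-Library.Extended_Nat"
    "Graph_Theory.Pair_Digraph"
begin

section \<open>Strongly regular graphs\<close>

text \<open>
  A finite simple graph is a \<^locale>\<open>pair_graph\<close>: a finite vertex set with a finite symmetric,
  loop-free set of ordered pairs, the edge \<open>vw\<close> being represented by both \<open>(v, w)\<close> and \<open>(w, v)\<close>.
  That locale admits the graph without vertices, which is excluded here.
\<close>

definition simple_graph :: "'v pair_pre_digraph \<Rightarrow> bool" where
  "simple_graph \<Gamma> \<longleftrightarrow> pair_graph \<Gamma> \<and> pverts \<Gamma> \<noteq> {}"

definition lk :: "'v pair_pre_digraph \<Rightarrow> 'v \<Rightarrow> 'v set" where
  "lk \<Gamma> v = {w. (v, w) \<in> parcs \<Gamma>}"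

definition regular_graph :: "'v pair_pre_digraph \<Rightarrow> nat \<Rightarrow> bool" where
  "regular_graph \<Gamma> k \<longleftrightarrow> simple_graph \<Gamma> \<and> (\<forall>v\<in>pverts \<Gamma>. card (lk \<Gamma> v) = k)"

definition strongly_regular_with ::
  "'v pair_pre_digraph \<Rightarrow> nat \<Rightarrow> nat \<Rightarrow> nat \<Rightarrow> nat \<Rightarrow> bool" where
  "strongly_regular_with \<Gamma> n k l m \<longleftrightarrow>
     regular_graph \<Gamma> k \<and> card (pverts \<Gamma>) = n \<and>
     (\<forall>v\<in>pverts \<Gamma>. \<forall>w\<in>pverts \<Gamma>.
        (v, w) \<in> parcs \<Gamma> \<longrightarrow> card (lk \<Gamma> v \<inter> lk \<Gamma> w) = l) \<and>
     (\<forall>v\<in>pverts \<Gamma>. \<forall>w\<in>pverts \<Gamma>.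
        (v, w) \<notin> parcs \<Gamma> \<and> v \<noteq> w \<longrightarrow> card (lk \<Gamma> v \<inter> lk \<Gamma> w) = m) \<and>
     1 \<le> k \<and> k < n - 1"

definition strongly_regular :: "'v pair_pre_digraph \<Rightarrow> bool" where
  "strongly_regular \<Gamma> \<longleftrightarrow> (\<exists>n k l m. strongly_regular_with \<Gamma> n k l m)"


section \<open>Groups given by generators and relators\<close>

text \<open>
  The letter \<open>(s, True)\<close> stands for the generator \<open>s\<close> and \<open>(s, False)\<close> for its inverse.
\<close>

type_synonym 'a word = "('a \<times> bool) list"

definition words :: "'a set \<Rightarrow> 'a word set" where
  "words S = lists (S \<times> UNIV)"

text \<open>
  The smallest congruence on the words over \<open>S\<close> that cancels adjacent mutually inverse
  letters and makes every relator trivial; its classes are the elements of \<open>\<langle>S | R\<rangle>\<close>.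
\<close>

inductive_set pres_rel :: "'a set \<Rightarrow> 'a word set \<Rightarrow> ('a word \<times> 'a word) set"
  for S :: "'a set" and R :: "'a word set" where
  refl: "u \<in> words S \<Longrightarrow> (u, u) \<in> pres_rel S R"
| sym: "(u, v) \<in> pres_rel S R \<Longrightarrow> (v, u) \<in> pres_rel S R"
| trans: "(u, v) \<in> pres_rel S R \<Longrightarrow> (v, w) \<in> pres_rel S R \<Longrightarrow> (u, w) \<in> pres_rel S R"
| append: "(u, u') \<in> pres_rel S R \<Longrightarrow> (v, v') \<in> pres_rel S R \<Longrightarrow>
    (u @ v, u' @ v') \<in> pres_rel S R"
| cancel: "s \<in> S \<Longrightarrow> ([(s, b), (s, \<not> b)], []) \<in> pres_rel S R"
| relator: "r \<in> R \<Longrightarrow> r \<in> words S \<Longrightarrow> (r, []) \<in> pres_rel S R"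

definition presented_group :: "'a set \<Rightarrow> 'a word set \<Rightarrow> 'a word set monoid" where
  "presented_group S R =
     \<lparr>carrier = words S // pres_rel S R,
      monoid.mult = (\<lambda>A B. \<Union>u\<in>A. \<Union>v\<in>B. pres_rel S R `` {u @ v}),
      one = pres_rel S R `` {[]}\<rparr>"

lemma pres_rel_words: "(u, v) \<in> pres_rel S R \<Longrightarrow> u \<in> words S \<and> v \<in> words S"
  by (induction rule: pres_rel.induct) (auto simp: words_def)

lemma equiv_pres_rel: "equiv (words S) (pres_rel S R)"
  by (intro equivI refl_onI symI transI)
     (auto dest: pres_rel_words intro: pres_rel.intros)

lemma presented_group_mult_class:
  assumes "u \<in> words S" "v \<in> words S"
  shows "(pres_rel S R `` {u}) \<otimes>\<^bsub>presented_group S R\<^esub> (pres_rel S R `` {v})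
    = pres_rel S R `` {u @ v}"
proof -
  have eq: "pres_rel S R `` {u' @ v'} = pres_rel S R `` {u @ v}"
    if "u' \<in> pres_rel S R `` {u}" "v' \<in> pres_rel S R `` {v}" for u' v'
  proof -
    from that have "(u, u') \<in> pres_rel S R" "(v, v') \<in> pres_rel S R" by blast+
    from equiv_class_eq[OF equiv_pres_rel pres_rel.append[OF this]] show ?thesis ..
  qed
  have "u \<in> pres_rel S R `` {u}" "v \<in> pres_rel S R `` {v}"
    using assms by (blast intro: pres_rel.refl)+
  with eq have "(\<Union>u'\<in>pres_rel S R `` {u}. \<Union>v'\<in>pres_rel S R `` {v}. pres_rel S R `` {u' @ v'})
      = pres_rel S R `` {u @ v}"
    by blast
  then show ?thesis
    by (simp add: presented_group_def)
qed

definition word_inv :: "'a word \<Rightarrow> 'a word" where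
  "word_inv u = rev (map (\<lambda>(s, b). (s, \<not> b)) u)"

lemma word_inv_words: "u \<in> words S \<Longrightarrow> word_inv u \<in> words S"
  by (auto simp: words_def word_inv_def)

lemma word_inv_left:
  "u \<in> words S \<Longrightarrow> (word_inv u @ u, []) \<in> pres_rel S R"
proof (induction u)
  case Nil
  then show ?case by (simp add: word_inv_def pres_rel.refl)
next
  case (Cons x u)
  obtain s b where x: "x = (s, b)" by (cases x)
  from Cons.prems have s: "s \<in> S" and u: "u \<in> words S"
    by (auto simp: x words_def)
  have "([(s, \<not> b), (s, b)], []) \<in> pres_rel S R"
    using pres_rel.cancel[OF s, of "\<not> b"] by simp
  from pres_rel.append[OF pres_rel.append[OF pres_rel.refl[OF word_inv_words[OF u]] this]
      pres_rel.refl[OF u]]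
  have "(word_inv (x # u) @ x # u, word_inv u @ u) \<in> pres_rel S R"
    by (simp add: word_inv_def x)
  then show ?case using Cons.IH[OF u] by (rule pres_rel.trans)
qed

lemma group_presented_group: "group (presented_group S R)"
proof -
  let ?G = "presented_group S R"
  let ?c = "\<lambda>u. pres_rel S R `` {u}"
  have car: "carrier ?G = ?c ` words S"
    by (auto simp: presented_group_def quotient_def)
  have one: "\<one>\<^bsub>?G\<^esub> = ?c []"
    by (simp add: presented_group_def)
  have app: "u @ v \<in> words S" if "u \<in> words S" "v \<in> words S" for u v
    using that by (simp add: words_def)
  have nil: "[] \<in> words S"
    by (simp add: words_def)
  show ?thesis
  proof (rule groupI)
    show "\<one>\<^bsub>?G\<^esub> \<in> carrier ?G"
      unfolding one car using nil by (rule imageI)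
  next
    fix x y assume "x \<in> carrier ?G" "y \<in> carrier ?G"
    then obtain u v where uv: "u \<in> words S" "x = ?c u" "v \<in> words S" "y = ?c v"
      unfolding car by blast
    have "x \<otimes>\<^bsub>?G\<^esub> y = ?c (u @ v)"
      unfolding uv(2,4) by (rule presented_group_mult_class[OF uv(1,3)])
    then show "x \<otimes>\<^bsub>?G\<^esub> y \<in> carrier ?G"
      unfolding car using app[OF uv(1,3)] by blast
  next
    fix x y z assume "x \<in> carrier ?G" "y \<in> carrier ?G" "z \<in> carrier ?G"
    then obtain u v w where uvw: "u \<in> words S" "x = ?c u" "v \<in> words S" "y = ?c v"
      "w \<in> words S" "z = ?c w"
      unfolding car by blast
    show "x \<otimes>\<^bsub>?G\<^esub> y \<otimes>\<^bsub>?G\<^esub> z = x \<otimes>\<^bsub>?G\<^esub> (y \<otimes>\<^bsub>?G\<^esub> z)"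
      unfolding uvw(2,4,6) presented_group_mult_class[OF uvw(1,3)]
        presented_group_mult_class[OF uvw(3,5)]
        presented_group_mult_class[OF app[OF uvw(1,3)] uvw(5)]
        presented_group_mult_class[OF uvw(1) app[OF uvw(3,5)]] append_assoc ..
  next
    fix x assume "x \<in> carrier ?G"
    then obtain u where u: "u \<in> words S" "x = ?c u"
      unfolding car by blast
    show "\<one>\<^bsub>?G\<^esub> \<otimes>\<^bsub>?G\<^esub> x = x"
      unfolding one u(2) presented_group_mult_class[OF nil u(1)] by simp
    have "?c (word_inv u) \<otimes>\<^bsub>?G\<^esub> x = \<one>\<^bsub>?G\<^esub>"
      unfolding one u(2) presented_group_mult_class[OF word_inv_words[OF u(1)] u(1)]
      by (rule equiv_class_eq[OF equiv_pres_rel word_inv_left[OF u(1)]])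
    moreover have "?c (word_inv u) \<in> carrier ?G"
      unfolding car using word_inv_words[OF u(1)] by (rule imageI)
    ultimately show "\<exists>y\<in>carrier ?G. y \<otimes>\<^bsub>?G\<^esub> x = \<one>\<^bsub>?G\<^esub>" by blast
  qed
qed


section \<open>Right-angled Artin groups\<close>

definition commutator_word :: "'a \<Rightarrow> 'a \<Rightarrow> 'a word" where
  "commutator_word v w = [(v, True), (w, True), (v, False), (w, False)]"

definition RAAG :: "'v pair_pre_digraph \<Rightarrow> 'v word set monoid" where
  "RAAG \<Gamma> = presented_group (pverts \<Gamma>) {commutator_word v w | v w. (v, w) \<in> parcs \<Gamma>}"


section \<open>Twisted conjugacy\<close>

definition twisted_conj :: "('a, 'b) monoid_scheme \<Rightarrow> ('a \<Rightarrow> 'a) \<Rightarrow> ('a \<times> 'a) set" where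
  "twisted_conj G \<phi> = {(x, y). x \<in> carrier G \<and> y \<in> carrier G \<and>
     (\<exists>g\<in>carrier G. x = g \<otimes>\<^bsub>G\<^esub> y \<otimes>\<^bsub>G\<^esub> inv\<^bsub>G\<^esub> (\<phi> g))}"

definition reidemeister_number :: "('a, 'b) monoid_scheme \<Rightarrow> ('a \<Rightarrow> 'a) \<Rightarrow> enat" where
  "reidemeister_number G \<phi> =
     (if finite (carrier G // twisted_conj G \<phi>)
      then enat (card (carrier G // twisted_conj G \<phi>)) else \<infinity>)"

text \<open>
  \<^term>\<open>auto G\<close> is the set of automorphisms of \<open>G\<close>, each extended by \<^term>\<open>undefined\<close>
  outside the carrier.
\<close>

definition R_infinity_property :: "('a, 'b) monoid_scheme \<Rightarrow> bool" where
  "R_infinity_property G \<longleftrightarrow> (\<forall>\<phi>\<in>auto G. reidemeister_number G \<phi> = \<infinity>)"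

end

theory Submission
  imports Defs "HOL-Algebra.Elementary_Groups" "HOL-Computational_Algebra.Formal_Power_Series"
    "Jordan_Normal_Form.Schur_Decomposition"
begin

text \<open>
  Let \<open>\<phi>\<close> be an automorphism of a finitely generated group \<open>G\<close>. The complex polynomial functions on
  \<open>G\<close> define a central filtration with torsion-free quotients. If \<open>d\<close> is minimal such that some
  nonzero functional on the \<open>d\<close>-th quotient is \<open>\<phi>\<close>-invariant, then elements fixed modulo the \<open>d\<close>-th
  term lie in it, so this functional separates infinitely many \<open>\<phi>\<close>-conjugacy classes. By finite
  dimension it suffices to find a nonzero \<open>\<phi>\<close>-invariant element in the complexified graded Lie algebra.

  For a right-angled Artin group on a regular non-complete graph, counting dimensions of centralisers
  shows that \<open>\<phi>\<close> permutes the twin classes of vertices (vertices with the same neighbours, up to each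
  other) on the abelianisation. Let \<open>U\<close> be a minimal invariant union of twin classes containing two
  distinct non-adjacent vertices. The eigenvalues of \<open>\<phi>\<close> on the lattice spanned by \<open>U\<close> have product
  \<open>\<plusminus>1\<close>, so an iterated bracket of eigenvectors in which each eigenvalue is used twice is
  invariant. It is nonzero since it is detected by an action of \<open>G\<close> by affine maps over a power
  series ring.
\<close>

section \<open>Linear algebra\<close>

text \<open>An automorphism need not have eigenvalue 1 on the abelianisation, so invariants must
  come from products of eigenvalues. The relation always available is that the determinant of an
  invertible integral matrix is a sign, which dictates brackets with 2 \<open>card U\<close>
  entries. Everything is done dually: no Lie algebra is built, and a bracket of vectors is a
  functional on polynomial functions. Regularity matters because in general a transvection may
  multiply u by v whenever lk(u) lies in the star of v; equal degrees turn this domination into u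
  and v being twins. Minimality of U keeps the bracket from vanishing: if an eigenvector vanished on
  the twin classes of two distinct non-adjacent vertices of U, the classes on which it vanishes
  would form a smaller invariant set. Since \<phi> need not be diagonalisable, there may be no pair
  of non-commuting eigenvectors. Hence only one of the two innermost entries is an eigenvector; the
  other is the first vector of a triangular basis that does not commute with it, and \<phi> still
  scales their bracket by two eigenvalues.\<close>

lemma integer_matrix_triangular:
  fixes M N :: "'v \<Rightarrow> 'v \<Rightarrow> int"
  assumes fin: "finite U"
    and inv: "\<forall>u\<in>U. \<forall>w\<in>U. (\<Sum>v\<in>U. M u v * N v w) = (if u = w then 1 else 0)"
  obtains es :: "complex list" and P :: "nat \<Rightarrow> 'v \<Rightarrow> complex"
  where "length es = card U" and "prod_list es ^ 2 = 1"
    and "\<And>a. a \<in> set es \<Longrightarrow> \<exists>x. (\<exists>v\<in>U. x v \<noteq> 0) \<and> (\<forall>v. v \<notin> U \<longrightarrow> x v = 0) \<and>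
      (\<forall>w\<in>U. (\<Sum>v\<in>U. of_int (M w v) * x v) = a * x w)"
    and "\<And>j v. j < card U \<Longrightarrow> v \<notin> U \<Longrightarrow> P j v = 0"
    and "\<And>j. j < card U \<Longrightarrow> \<exists>c. \<forall>w\<in>U.
      (\<Sum>v\<in>U. of_int (M w v) * P j v) = es ! j * P j w + (\<Sum>i<j. c i * P i w)"
    and "\<And>y. \<exists>c. \<forall>w\<in>U. y w = (\<Sum>j<card U. c j * P j w)"
proof -
  let ?n = "card U"
  obtain b where b: "bij_betw b {0..<?n} U"
    using ex_bij_betw_nat_finite[OF fin] by blast
  define b' where "b' = inv_into {0..<?n} b"
  have b_U: "b i \<in> U" if "i < ?n" for i
    using b that by (auto simp: bij_betw_def)
  have b_eq: "b i = b j \<longleftrightarrow> i = j" if "i < ?n" "j < ?n" for i j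
    using b that by (auto simp: bij_betw_def inj_on_def)
  have b': "b (b' w) = w" "b' w < ?n" if "w \<in> U" for w
    using b that bij_betw_inv_into_right[OF b that] bij_betw_apply[OF bij_betw_inv_into[OF b] that]
    by (auto simp: b'_def)
  have b'b: "b' (b i) = i" if "i < ?n" for i
    using bij_betw_inv_into_left[OF b, of i] that by (simp add: b'_def)
  have reindex: "(\<Sum>i = 0..<?n. g (b i)) = (\<Sum>v\<in>U. g v)" for g :: "'v \<Rightarrow> 'c::comm_monoid_add"
    by (rule sum.reindex_bij_betw[OF b])
  define Mi where "Mi = mat ?n ?n (\<lambda>(i, j). M (b i) (b j))"
  define Ni where "Ni = mat ?n ?n (\<lambda>(i, j). N (b i) (b j))"
  define A :: "complex mat" where "A = map_mat of_int Mi"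
  have carr: "Mi \<in> carrier_mat ?n ?n" "Ni \<in> carrier_mat ?n ?n" "A \<in> carrier_mat ?n ?n"
    by (auto simp: Mi_def Ni_def A_def)
  have "Mi * Ni = 1\<^sub>m ?n"
  proof (rule eq_matI)
    fix i j assume "i < dim_row (1\<^sub>m ?n)" "j < dim_col (1\<^sub>m ?n)"
    then have ij: "i < ?n" "j < ?n" by auto
    then have "(Mi * Ni) $$ (i, j) = (\<Sum>k = 0..<?n. M (b i) (b k) * N (b k) (b j))"
      by (simp add: Mi_def Ni_def scalar_prod_def)
    also have "\<dots> = (if i = j then 1 else 0)"
      using reindex[of "\<lambda>v. M (b i) v * N v (b j)"] inv b_U ij b_eq by simp
    finally show "(Mi * Ni) $$ (i, j) = 1\<^sub>m ?n $$ (i, j)" using ij by simp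
  qed (use carr in auto)
  \<comment> \<open>Both determinants are integers, so \<open>det Mi\<close> is a unit of the
    integers; squaring removes the sign.\<close>
  then have "det Mi * det Ni = 1"
    using det_mult[OF carr(1,2)] by simp
  then have "det Mi = 1 \<or> det Mi = -1"
    using zmult_eq_1_iff by blast
  then have detA: "det A ^ 2 = 1"
    by (auto simp: A_def of_int_hom.hom_det)
  obtain es where es: "char_poly A = (\<Prod>a\<leftarrow>es. [:- a, 1:])" "length es = ?n"
    using char_poly_factorized[OF carr(3)] by blast
  obtain B P Q where dec: "schur_decomposition A es = (B, P, Q)"
    by (cases "schur_decomposition A es") auto
  from schur_decomposition[OF carr(3) es(1) dec]
  have wit: "similar_mat_wit A B P Q" and tri: "upper_triangular B" and diag: "diag_mat B = es"
    by auto
  from similar_mat_witD2[OF carr(3) wit]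
  have PQ: "P * Q = 1\<^sub>m ?n" "Q * P = 1\<^sub>m ?n" "A = P * B * Q"
    and BPQ: "B \<in> carrier_mat ?n ?n" "P \<in> carrier_mat ?n ?n" "Q \<in> carrier_mat ?n ?n"
    by auto
  have "det A = det B" using det_similar wit unfolding similar_mat_def by blast
  also have "\<dots> = prod_list es" using det_upper_triangular[OF tri BPQ(1)] diag by simp
  finally have prod: "prod_list es ^ 2 = 1" using detA by simp
  have A_apply: "(\<Sum>v\<in>U. of_int (M w v) * y (b' v)) = (\<Sum>k = 0..<?n. A $$ (b' w, k) * y k)"
    if "w \<in> U" for w and y :: "nat \<Rightarrow> complex"
    using that unfolding reindex[symmetric]
    by (intro sum.cong HOL.refl) (auto simp: A_def Mi_def b' b'b)
  have eig: "\<exists>x. (\<exists>v\<in>U. x v \<noteq> 0) \<and> (\<forall>v. v \<notin> U \<longrightarrow> x v = 0) \<and>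
       (\<forall>w\<in>U. (\<Sum>v\<in>U. of_int (M w v) * x v) = a * x w)" if a: "a \<in> set es" for a
  proof -
    have "poly (char_poly A) a = 0"
      unfolding es(1) poly_prod_list using a by (auto simp: prod_list_zero_iff)
    then obtain z where z: "z \<in> carrier_vec ?n" "z \<noteq> 0\<^sub>v ?n" "A *\<^sub>v z = a \<cdot>\<^sub>v z"
      using eigenvalue_root_char_poly[OF carr(3)] carr(3) unfolding eigenvalue_def eigenvector_def by auto
    define x where "x = (\<lambda>v. if v \<in> U then vec_index z (b' v) else 0)"
    obtain i where i: "i < ?n" "vec_index z i \<noteq> 0"
      using z(1,2) by (metis carrier_vecD eq_vecI index_zero_vec)
    have "x (b i) \<noteq> 0" using i b_U b'b by (simp add: x_def)
    moreover have "(\<Sum>v\<in>U. of_int (M w v) * x v) = a * x w" if w: "w \<in> U" for w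
    proof -
      have "(\<Sum>v\<in>U. of_int (M w v) * x v) = (\<Sum>v\<in>U. of_int (M w v) * vec_index z (b' v))"
        by (intro sum.cong) (auto simp: x_def)
      also have "\<dots> = vec_index (A *\<^sub>v z) (b' w)"
        using A_apply[OF w, of "vec_index z"] b'(2)[OF w] carr(3) z(1) by (simp add: scalar_prod_def)
      also have "\<dots> = a * x w" using z b'(2)[OF w] w by (simp add: x_def)
      finally show ?thesis .
    qed
    ultimately show ?thesis using i b_U by (intro exI[of _ x]) (auto simp: x_def)
  qed
  define p where "p = (\<lambda>j v. if v \<in> U then P $$ (b' v, j) else 0)"
  have triang: "\<exists>c. \<forall>w\<in>U.
      (\<Sum>v\<in>U. of_int (M w v) * p j v) = es ! j * p j w + (\<Sum>i<j. c i * p i w)" if j: "j < ?n" for j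
  proof (intro exI ballI)
    fix w assume w: "w \<in> U"
    \<comment> \<open>Column j of this identity is the triangular relation for the j-th column of
      \<open>P\<close>.\<close>
    have AP: "A * P = P * B"
    proof -
      have "A * P = P * B * (Q * P)"
        unfolding PQ(3) using BPQ by (simp add: assoc_mult_mat[of _ ?n ?n _ ?n _ ?n])
      then show ?thesis using PQ(2) BPQ by simp
    qed
    have "(\<Sum>v\<in>U. of_int (M w v) * p j v) = (\<Sum>v\<in>U. of_int (M w v) * P $$ (b' v, j))"
      by (intro sum.cong) (auto simp: p_def)
    also have "\<dots> = (A * P) $$ (b' w, j)"
      using A_apply[OF w, of "\<lambda>k. P $$ (k, j)"] b'(2)[OF w] carr(3) BPQ(2) j
      by (simp add: scalar_prod_def)
    also have "\<dots> = (\<Sum>i = 0..<?n. P $$ (b' w, i) * B $$ (i, j))"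
      unfolding AP using b'(2)[OF w] BPQ j by (simp add: scalar_prod_def)
    also have "\<dots> = (\<Sum>i\<in>{..j}. P $$ (b' w, i) * B $$ (i, j))"
      using tri BPQ(1) j by (intro sum.mono_neutral_right) (auto simp: upper_triangularD)
    also have "\<dots> = es ! j * p j w + (\<Sum>i<j. B $$ (i, j) * p i w)"
      using j BPQ(1) w diag
      by (auto simp: p_def diag_mat_def lessThan_Suc_atMost[symmetric] mult.commute)
    finally show "(\<Sum>v\<in>U. of_int (M w v) * p j v) = es ! j * p j w + (\<Sum>i<j. B $$ (i, j) * p i w)" .
  qed
  have span: "\<exists>c. \<forall>w\<in>U. y w = (\<Sum>j<?n. c j * p j w)" for y :: "'v \<Rightarrow> complex"
  proof (intro exI ballI)
    fix w assume w: "w \<in> U"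
    let ?y = "vec ?n (\<lambda>i. y (b i))"
    have y: "?y \<in> carrier_vec ?n" by simp
    have "P *\<^sub>v (Q *\<^sub>v ?y) = ?y"
      using assoc_mult_mat_vec[OF BPQ(2,3) y] PQ(1) y by simp
    then have "y w = vec_index (P *\<^sub>v (Q *\<^sub>v ?y)) (b' w)"
      using b'[OF w] by simp
    also have "\<dots> = (\<Sum>j = 0..<?n. P $$ (b' w, j) * vec_index (Q *\<^sub>v ?y) j)"
      using b'(2)[OF w] BPQ by (simp add: scalar_prod_def)
    also have "\<dots> = (\<Sum>j<?n. vec_index (Q *\<^sub>v ?y) j * p j w)"
      using w by (simp add: p_def mult.commute atLeast0LessThan)
    finally show "y w = (\<Sum>j<?n. vec_index (Q *\<^sub>v ?y) j * p j w)" .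
  qed
  have "p j v = 0" if "j < ?n" "v \<notin> U" for j v using that by (simp add: p_def)
  from that[OF es(2) prod eig this triang span] show ?thesis .
qed

text \<open>Gaussian elimination, removing one coordinate together with a pivot vector. The vectors
  form an indexed family because the iterates to which this is applied may coincide.\<close>

lemma finite_dependence:
  fixes h :: "'w \<Rightarrow> 'u \<Rightarrow> 'f::field"
  assumes "finite U" "finite W" "card U < card W"
  shows "\<exists>c. (\<exists>w\<in>W. c w \<noteq> 0) \<and> (\<forall>u\<in>U. (\<Sum>w\<in>W. c w * h w u) = 0)"
  using assms
proof (induction U arbitrary: W h rule: finite_induct)
  case empty
  then have "W \<noteq> {}" by auto
  then show ?case by (auto intro!: exI[of _ "\<lambda>_. 1"])
next
  case (insert u U)
  show ?case
  proof (cases "\<forall>w\<in>W. h w u = 0")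
    case True
    obtain c where "\<exists>w\<in>W. c w \<noteq> 0" "\<forall>u\<in>U. (\<Sum>w\<in>W. c w * h w u) = 0"
      using insert.IH[of W h] insert.prems insert.hyps by auto
    then show ?thesis using True by (intro exI[of _ c]) auto
  next
    case False
    then obtain w0 where w0: "w0 \<in> W" "h w0 u \<noteq> 0" by auto
    define W' where "W' = W - {w0}"
    have W: "W = insert w0 W'" "w0 \<notin> W'" "finite W'"
      using w0 insert.prems by (auto simp: W'_def)
    have "card U < card W'"
      using insert.prems insert.hyps W by auto
    then obtain c where c: "\<exists>w\<in>W'. c w \<noteq> 0"
      "\<forall>x\<in>U. (\<Sum>w\<in>W'. c w * (h w x - h w u / h w0 u * h w0 x)) = 0"
      using insert.IH[of W' "\<lambda>w x. h w x - h w u / h w0 u * h w0 x"] W by auto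
    \<comment> \<open>The coefficient of the pivot \<open>w0\<close> is forced by the vanishing of
      coordinate \<open>u\<close>.\<close>
    define c' where "c' = (\<lambda>w. if w = w0 then - (\<Sum>w\<in>W'. c w * h w u) / h w0 u else c w)"
    have c'W: "(\<Sum>w\<in>W'. c' w * h w x) = (\<Sum>w\<in>W'. c w * h w x)" for x
      using W by (intro sum.cong) (auto simp: c'_def)
    have sum: "(\<Sum>w\<in>W. c' w * h w x)
        = (\<Sum>w\<in>W'. c w * h w x) - (\<Sum>w\<in>W'. c w * h w u) / h w0 u * h w0 x" for x
      using W c'W by (simp add: c'_def)
    have "(\<Sum>w\<in>W. c' w * h w x) = 0" if "x \<in> insert u U" for x
    proof (cases "x = u")
      case True
      then show ?thesis using w0 by (simp add: sum)
    next
      case False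
      with that c have "0 = (\<Sum>w\<in>W'. c w * (h w x - h w u / h w0 u * h w0 x))" by auto
      also have "\<dots> = (\<Sum>w\<in>W'. c w * h w x) - (\<Sum>w\<in>W'. c w * h w u) / h w0 u * h w0 x"
        by (simp add: right_diff_distrib sum_subtractf sum_distrib_right sum_divide_distrib mult.assoc)
      finally show ?thesis by (simp add: sum)
    qed
    moreover have "\<exists>w\<in>W. c' w \<noteq> 0"
      using c(1) W by (auto simp: c'_def)
    ultimately show ?thesis by blast
  qed
qed

text \<open>This is p(T) f for the operator T that precomposes with \<phi>.\<close>

definition orbit_poly :: "('a \<Rightarrow> 'a) \<Rightarrow> complex poly \<Rightarrow> ('a \<Rightarrow> complex) \<Rightarrow> 'a \<Rightarrow> complex" where
  "orbit_poly \<phi> p f x = (\<Sum>i\<le>degree p. coeff p i * f ((\<phi> ^^ i) x))"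

lemma orbit_poly_bound:
  assumes "degree p \<le> n"
  shows "orbit_poly \<phi> p f x = (\<Sum>i\<le>n. coeff p i * f ((\<phi> ^^ i) x))"
  unfolding orbit_poly_def using assms
  by (intro sum.mono_neutral_left) (auto simp: coeff_eq_0)

lemma orbit_poly_pCons:
  "orbit_poly \<phi> (pCons c p) f x = c * f x + orbit_poly \<phi> p f (\<phi> x)"
proof -
  have "orbit_poly \<phi> (pCons c p) f x
      = (\<Sum>i\<le>Suc (degree p). coeff (pCons c p) i * f ((\<phi> ^^ i) x))"
    by (rule orbit_poly_bound) (simp add: degree_pCons_le)
  also have "\<dots> = c * f x + orbit_poly \<phi> p f (\<phi> x)"
    by (simp add: sum.atMost_Suc_shift orbit_poly_def funpow_swap1 del: sum.atMost_Suc)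
  finally show ?thesis .
qed

lemma orbit_poly_0: "orbit_poly \<phi> 0 f x = 0"
  by (simp add: orbit_poly_def)

lemma orbit_poly_root:
  "orbit_poly \<phi> ([:- a, 1:] * q) f x = orbit_poly \<phi> q f (\<phi> x) - a * orbit_poly \<phi> q f x"
proof -
  have "[:- a, 1:] * q = smult (- a) q + pCons 0 q" by simp
  moreover have "degree (smult (- a) q + pCons 0 q) \<le> Suc (degree q)"
    by (intro degree_add_le order_trans[OF degree_smult_le] degree_pCons_le) simp
  ultimately have "orbit_poly \<phi> ([:- a, 1:] * q) f x
      = (\<Sum>i\<le>Suc (degree q). coeff (smult (- a) q + pCons 0 q) i * f ((\<phi> ^^ i) x))"
    by (simp only: orbit_poly_bound)
  also have "\<dots> = - a * (\<Sum>i\<le>Suc (degree q). coeff q i * f ((\<phi> ^^ i) x))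
      + (\<Sum>i\<le>Suc (degree q). coeff (pCons 0 q) i * f ((\<phi> ^^ i) x))"
    by (simp only: coeff_add coeff_smult distrib_right sum.distrib sum_distrib_left mult.assoc)
  also have "\<dots> = - a * orbit_poly \<phi> q f x + orbit_poly \<phi> (pCons 0 q) f x"
    by (simp only: orbit_poly_bound[of q "Suc (degree q)"] le_SucI order_refl
        orbit_poly_bound[of "pCons 0 q" "Suc (degree q)"] degree_pCons_le)
  finally show ?thesis by (simp add: orbit_poly_pCons)
qed

text \<open>Being polynomial along every affine line replaces polynomials in several variables: to
  find a common non-zero of two functions it is enough to look at the line through a non-zero of
  each.\<close>

definition line_poly :: "(('v \<Rightarrow> complex) \<Rightarrow> complex) \<Rightarrow> bool" where
  "line_poly F \<longleftrightarrow> (\<forall>l m. \<exists>p. \<forall>s. F (\<lambda>v. l v + s * m v) = poly p s)"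

lemma line_poly_diff:
  assumes "line_poly F" "line_poly H"
  shows "line_poly (\<lambda>l. F l - H l)"
  unfolding line_poly_def
proof (intro allI)
  fix l m
  obtain p q where "\<forall>s. F (\<lambda>v. l v + s * m v) = poly p s" "\<forall>s. H (\<lambda>v. l v + s * m v) = poly q s"
    using assms unfolding line_poly_def by metis
  then show "\<exists>p. \<forall>s. F (\<lambda>v. l v + s * m v) - H (\<lambda>v. l v + s * m v) = poly p s"
    by (intro exI[of _ "p - q"]) simp
qed

lemma line_poly_mult:
  assumes "line_poly F" "line_poly H"
  shows "line_poly (\<lambda>l. F l * H l)"
  unfolding line_poly_def
proof (intro allI)
  fix l m
  obtain p q where "\<forall>s. F (\<lambda>v. l v + s * m v) = poly p s" "\<forall>s. H (\<lambda>v. l v + s * m v) = poly q s"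
    using assms unfolding line_poly_def by metis
  then show "\<exists>p. \<forall>s. F (\<lambda>v. l v + s * m v) * H (\<lambda>v. l v + s * m v) = poly p s"
    by (intro exI[of _ "p * q"]) simp
qed

lemma line_poly_linear: "line_poly (\<lambda>l. \<Sum>v\<in>D. x v * l v)"
  unfolding line_poly_def
proof (intro allI)
  fix l m :: "'a \<Rightarrow> complex"
  show "\<exists>p. \<forall>s. (\<Sum>v\<in>D. x v * (l v + s * m v)) = poly p s"
    by (intro exI[of _ "[:\<Sum>v\<in>D. x v * l v, \<Sum>v\<in>D. x v * m v:]"])
      (simp add: sum_distrib_left algebra_simps sum.distrib)
qed

text \<open>On the line from \<open>l\<close> to \<open>m\<close> both functions restrict to nonzero
  polynomials in one variable, whose product has finitely many roots.\<close>

lemma line_poly_common_nonzero: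
  assumes F: "line_poly F" "F l \<noteq> 0" and H: "line_poly H" "H m \<noteq> 0"
  shows "\<exists>l. F l * H l \<noteq> 0"
proof -
  obtain p where p: "\<And>s. F (\<lambda>v. l v + s * (m v - l v)) = poly p s"
    using F(1) unfolding line_poly_def by metis
  obtain q where q: "\<And>s. H (\<lambda>v. l v + s * (m v - l v)) = poly q s"
    using H(1) unfolding line_poly_def by metis
  have "poly p 0 \<noteq> 0" "poly q 1 \<noteq> 0"
    using F(2) H(2) p[of 0] q[of 1] by auto
  then have "p * q \<noteq> 0" by auto
  then have "finite {s. poly (p * q) s = 0}" by (rule poly_roots_finite)
  then obtain s where "poly (p * q) s \<noteq> 0"
    using ex_new_if_finite[OF infinite_UNIV_char_0, of "{s. poly (p * q) s = 0}"] by auto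
  then have "F (\<lambda>v. l v + s * (m v - l v)) * H (\<lambda>v. l v + s * (m v - l v)) \<noteq> 0"
    using p[of s] q[of s] by simp
  then show ?thesis by (rule exI[of _ "\<lambda>v. l v + s * (m v - l v)"])
qed

lemma line_poly_prod_nonzero:
  "(\<And>a. a \<in> set as \<Longrightarrow> line_poly (F a) \<and> (\<exists>l. F a l \<noteq> 0)) \<Longrightarrow>
    line_poly (\<lambda>l. prod_list (map (\<lambda>a. F a l) as)) \<and> (\<exists>l. prod_list (map (\<lambda>a. F a l) as) \<noteq> 0)"
proof (induction "as")
  case Nil
  show ?case by (auto simp: line_poly_def intro!: exI[of _ 1])
next
  case (Cons a as)
  then have IH: "line_poly (\<lambda>l. prod_list (map (\<lambda>a. F a l) as))"
    "\<exists>l. prod_list (map (\<lambda>a. F a l) as) \<noteq> 0" by auto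
  have a: "line_poly (F a)" "\<exists>l. F a l \<noteq> 0" using Cons.prems by auto
  show ?case
    using line_poly_mult[OF a(1) IH(1)] line_poly_common_nonzero[OF a(1) _ IH(1)] a(2) IH(2)
    by (simp only: list.map prod_list.Cons) blast
qed

lemma prod_list_remove1:
  "a \<in> set xs \<Longrightarrow> prod_list xs = a * prod_list (remove1 a (xs :: 'b::comm_monoid_mult list))"
  by (induction xs) (auto simp: mult.left_commute)

section \<open>Polynomial functions on a group\<close>

context group
begin

text \<open>Degree at most d in the sense of finite differences. Differences on both sides are
  required so that elements of \<open>poly_ker d\<close> can be split off a product from the left
  and from the right.\<close>

primrec poly_fun :: "nat \<Rightarrow> ('a \<Rightarrow> complex) \<Rightarrow> bool" where
  "poly_fun 0 f \<longleftrightarrow> (\<exists>c. \<forall>x\<in>carrier G. f x = c)"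
| "poly_fun (Suc d) f \<longleftrightarrow> (\<forall>h\<in>carrier G.
     poly_fun d (\<lambda>k. f (h \<otimes> k) - f k) \<and> poly_fun d (\<lambda>k. f (k \<otimes> h) - f k))"

lemma poly_fun_cong:
  "(\<And>x. x \<in> carrier G \<Longrightarrow> f x = g x) \<Longrightarrow> poly_fun d f \<longleftrightarrow> poly_fun d g"
proof (induction d arbitrary: f g)
  case 0
  then show ?case by simp
next
  case (Suc d)
  have "poly_fun d (\<lambda>k. f (h \<otimes> k) - f k) = poly_fun d (\<lambda>k. g (h \<otimes> k) - g k)"
    "poly_fun d (\<lambda>k. f (k \<otimes> h) - f k) = poly_fun d (\<lambda>k. g (k \<otimes> h) - g k)"
    if "h \<in> carrier G" for h
    using that by (auto intro!: Suc.IH simp: Suc.prems)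
  then show ?case by simp
qed

lemma poly_fun_lincomb:
  "poly_fun d f \<Longrightarrow> poly_fun d g \<Longrightarrow> poly_fun d (\<lambda>x. a * f x + b * g x)"
proof (induction d arbitrary: f g)
  case 0
  then obtain c d where "\<forall>x\<in>carrier G. f x = c" "\<forall>x\<in>carrier G. g x = d" by auto
  then show ?case by (auto intro!: exI[of _ "a * c + b * d"])
next
  case (Suc d)
  have eq: "(a * f x + b * g x) - (a * f y + b * g y) = a * (f x - f y) + b * (g x - g y)" for x y
    by (simp add: right_diff_distrib)
  show ?case
    unfolding poly_fun.simps(2) eq
  proof (intro ballI conjI Suc.IH)
    fix h assume "h \<in> carrier G"
    with Suc.prems show "poly_fun d (\<lambda>k. f (h \<otimes> k) - f k)" "poly_fun d (\<lambda>k. g (h \<otimes> k) - g k)"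
      "poly_fun d (\<lambda>k. f (k \<otimes> h) - f k)" "poly_fun d (\<lambda>k. g (k \<otimes> h) - g k)"
      by simp_all
  qed
qed

lemma poly_fun_const: "poly_fun d (\<lambda>x. c)"
  by (induction d arbitrary: c) auto

lemma poly_fun_SucI: "poly_fun d f \<Longrightarrow> poly_fun (Suc d) f"
proof (induction d arbitrary: f)
  case 0
  then obtain c where "\<forall>x\<in>carrier G. f x = c" by auto
  then show ?case by (auto intro!: exI[of _ 0])
next
  case (Suc d)
  show ?case
    unfolding poly_fun.simps(2)[of "Suc d"]
  proof (intro ballI conjI Suc.IH)
    fix h assume "h \<in> carrier G"
    with Suc.prems show "poly_fun d (\<lambda>k. f (h \<otimes> k) - f k)" "poly_fun d (\<lambda>k. f (k \<otimes> h) - f k)"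
      by simp_all
  qed
qed

lemma poly_fun_mono: "d \<le> e \<Longrightarrow> poly_fun d f \<Longrightarrow> poly_fun e f"
  by (induction rule: dec_induct) (auto intro: poly_fun_SucI simp del: poly_fun.simps)

lemma poly_fun_diff:
  assumes "poly_fun (Suc d) f" "h \<in> carrier G"
  shows "poly_fun d (\<lambda>k. f (h \<otimes> k) - f k)" "poly_fun d (\<lambda>k. f (k \<otimes> h) - f k)"
  using assms by simp_all

lemma poly_fun_lshift:
  assumes f: "poly_fun d f" and h: "h \<in> carrier G"
  shows "poly_fun d (\<lambda>k. f (h \<otimes> k))"
proof -
  have "poly_fun d (\<lambda>k. f (h \<otimes> k) - f k)"
    using poly_fun_SucI[OF f] h by simp
  from poly_fun_lincomb[OF this f, of 1 1] show ?thesis by simp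
qed

lemma poly_fun_hom:
  assumes \<phi>: "\<phi> \<in> hom G G"
  shows "poly_fun d f \<Longrightarrow> poly_fun d (\<lambda>x. f (\<phi> x))"
proof (induction d arbitrary: f)
  case 0
  then show ?case by (auto simp: hom_in_carrier[OF \<phi>])
next
  case (Suc d)
  have "poly_fun d (\<lambda>k. f (\<phi> (h \<otimes> k)) - f (\<phi> k))" "poly_fun d (\<lambda>k. f (\<phi> (k \<otimes> h)) - f (\<phi> k))"
    if h: "h \<in> carrier G" for h
  proof -
    have "\<phi> h \<in> carrier G"
      using \<phi> h by (rule hom_in_carrier)
    with Suc.prems have "poly_fun d (\<lambda>k. f (\<phi> h \<otimes> \<phi> k) - f (\<phi> k))"
      "poly_fun d (\<lambda>k. f (\<phi> k \<otimes> \<phi> h) - f (\<phi> k))"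
      by (auto intro: Suc.IH[of "\<lambda>k. f (\<phi> h \<otimes> k) - f k"] Suc.IH[of "\<lambda>k. f (k \<otimes> \<phi> h) - f k"])
    moreover have "f (\<phi> (h \<otimes> k)) - f (\<phi> k) = f (\<phi> h \<otimes> \<phi> k) - f (\<phi> k)"
      "f (\<phi> (k \<otimes> h)) - f (\<phi> k) = f (\<phi> k \<otimes> \<phi> h) - f (\<phi> k)" if "k \<in> carrier G" for k
      using hom_mult[OF \<phi>] h that by simp_all
    ultimately show "poly_fun d (\<lambda>k. f (\<phi> (h \<otimes> k)) - f (\<phi> k))"
      "poly_fun d (\<lambda>k. f (\<phi> (k \<otimes> h)) - f (\<phi> k))"
      by (simp_all cong: poly_fun_cong)
  qed
  then show ?case by simp
qed

text \<open>A torsion-free replacement of the lower central series, intrinsic and hence characteristic.\<close>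

definition poly_ker :: "nat \<Rightarrow> 'a set" where
  "poly_ker d = {x \<in> carrier G. \<forall>f. poly_fun d f \<longrightarrow> f x = f \<one>}"

lemma poly_ker_carrier: "x \<in> poly_ker d \<Longrightarrow> x \<in> carrier G"
  by (simp add: poly_ker_def)

lemma poly_kerD: "x \<in> poly_ker d \<Longrightarrow> poly_fun d f \<Longrightarrow> f x = f \<one>"
  by (simp add: poly_ker_def)

lemma poly_kerI: "x \<in> carrier G \<Longrightarrow> (\<And>f. poly_fun d f \<Longrightarrow> f x = f \<one>) \<Longrightarrow> x \<in> poly_ker d"
  by (simp add: poly_ker_def)

lemma poly_ker_0: "poly_ker 0 = carrier G"
  by (force simp: poly_ker_def)

lemma poly_ker_antimono: "d \<le> e \<Longrightarrow> poly_ker e \<subseteq> poly_ker d"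
  by (auto simp: poly_ker_def intro: poly_fun_mono)

lemma poly_ker_one: "\<one> \<in> poly_ker d"
  by (simp add: poly_ker_def)

text \<open>The difference of \<open>f\<close> by \<open>h\<close> on the right has degree d, hence
  takes the same value at \<open>g\<close> and at \<open>\<one>\<close>. So up to its value at
  \<open>\<one>\<close>, \<open>f\<close> is additive on \<open>poly_ker d\<close>.\<close>

lemma poly_fun_mult_left:
  assumes f: "poly_fun (Suc d) f" and g: "g \<in> poly_ker d" and h: "h \<in> carrier G"
  shows "f (g \<otimes> h) = f g + f h - f \<one>"
proof -
  have "f (g \<otimes> h) - f g = f (\<one> \<otimes> h) - f \<one>"
    using g poly_fun_diff(2)[OF f h] unfolding poly_ker_def by blast
  then show ?thesis using h by (simp add: algebra_simps)
qed

lemma poly_fun_mult_right: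
  assumes f: "poly_fun (Suc d) f" and g: "g \<in> poly_ker d" and h: "h \<in> carrier G"
  shows "f (h \<otimes> g) = f g + f h - f \<one>"
proof -
  have "f (h \<otimes> g) - f g = f (h \<otimes> \<one>) - f \<one>"
    using g poly_fun_diff(1)[OF f h] unfolding poly_ker_def by blast
  then show ?thesis using h by (simp add: algebra_simps)
qed

lemma poly_fun_inv:
  assumes f: "poly_fun (Suc d) f" and g: "g \<in> poly_ker d"
  shows "f (inv g) = 2 * f \<one> - f g"
proof -
  have "g \<in> carrier G" by (rule poly_ker_carrier[OF g])
  with poly_fun_mult_left[OF f g, of "inv g"] show ?thesis by (simp add: algebra_simps)
qed

lemma poly_ker_mult: "x \<in> poly_ker d \<Longrightarrow> y \<in> poly_ker d \<Longrightarrow> x \<otimes> y \<in> poly_ker d"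
  by (rule poly_kerI) (simp_all add: poly_ker_carrier poly_fun_mult_left[OF poly_fun_SucI] poly_kerD)

lemma poly_ker_inv: "x \<in> poly_ker d \<Longrightarrow> inv x \<in> poly_ker d"
  by (rule poly_kerI) (simp_all add: poly_ker_carrier poly_fun_inv[OF poly_fun_SucI] poly_kerD)

text \<open>Compare the degree d function sending k to f(h k h^-1) - f(h k) at \<open>g\<close> and
  at \<open>\<one>\<close>.\<close>

lemma poly_fun_conj:
  assumes f: "poly_fun (Suc d) f" and g: "g \<in> poly_ker d" and h: "h \<in> carrier G"
  shows "f (h \<otimes> g \<otimes> inv h) = f g"
proof -
  have gc: "g \<in> carrier G" by (rule poly_ker_carrier[OF g])
  have "poly_fun d (\<lambda>k. f (h \<otimes> k \<otimes> inv h) - f (h \<otimes> k))"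
    using poly_fun_lshift[OF poly_fun_diff(2)[OF f, of "inv h"] h] h by simp
  then have "f (h \<otimes> g \<otimes> inv h) - f (h \<otimes> g) = f (h \<otimes> \<one> \<otimes> inv h) - f (h \<otimes> \<one>)"
    using g unfolding poly_ker_def by blast
  with poly_fun_mult_right[OF f g h] h show ?thesis by simp
qed

lemma poly_ker_conj: "x \<in> poly_ker d \<Longrightarrow> h \<in> carrier G \<Longrightarrow> h \<otimes> x \<otimes> inv h \<in> poly_ker d"
  by (rule poly_kerI) (simp_all add: poly_ker_carrier poly_fun_conj[OF poly_fun_SucI] poly_kerD)

text \<open>Centrality of the filtration: functions of degree d + 1 are additive and conjugation
  invariant on \<open>poly_ker d\<close>, so they do not see commutators with it.\<close>

lemma poly_ker_commutator:
  assumes y: "y \<in> poly_ker d" and g: "g \<in> carrier G"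
  shows "g \<otimes> y \<otimes> inv g \<otimes> inv y \<in> poly_ker (Suc d)"
proof -
  have "f (g \<otimes> y \<otimes> inv g \<otimes> inv y) = f \<one>" if f: "poly_fun (Suc d) f" for f
    using poly_fun_mult_left[OF f poly_ker_conj[OF y g], of "inv y"] poly_fun_conj[OF f y g]
      poly_fun_inv[OF f y] poly_ker_carrier[OF y] by simp
  then show ?thesis using g poly_ker_carrier[OF y] by (simp add: poly_ker_def del: poly_fun.simps)
qed

text \<open>The source of torsion-freeness: the complex values f(x^n) are pairwise distinct as soon
  as f(x) differs from f(1).\<close>

lemma poly_fun_pow:
  assumes f: "poly_fun (Suc d) f" and x: "x \<in> poly_ker d"
  shows "x [^] n \<in> poly_ker d \<and> f (x [^] (n::nat)) - f \<one> = of_nat n * (f x - f \<one>)"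
proof (induction n)
  case 0
  then show ?case by (simp add: poly_ker_one)
next
  case (Suc n)
  then have xn: "x [^] n \<in> poly_ker d" and IH: "f (x [^] n) - f \<one> = of_nat n * (f x - f \<one>)"
    by auto
  have "f (x [^] Suc n) - f \<one> = (f (x [^] n) - f \<one>) + (f x - f \<one>)"
    using poly_fun_mult_left[OF f xn poly_ker_carrier[OF x]] by simp
  also have "\<dots> = of_nat (Suc n) * (f x - f \<one>)"
    unfolding IH by (simp add: distrib_right)
  finally show ?case using poly_ker_mult[OF xn x] by simp
qed

section \<open>The bracket pairing\<close>

text \<open>The transpose of the bracket with \<open>g\<close>; \<open>bracket_diff_poly_ker\<close>
  makes this precise.\<close>

definition bracket_diff :: "'a \<Rightarrow> ('a \<Rightarrow> complex) \<Rightarrow> 'a \<Rightarrow> complex" where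
  "bracket_diff g f = (\<lambda>k. f (g \<otimes> k) - f (k \<otimes> g))"

lemma poly_fun_bracket_diff:
  assumes "poly_fun (Suc d) f" "g \<in> carrier G"
  shows "poly_fun d (bracket_diff g f)"
  using poly_fun_lincomb[OF poly_fun_diff[OF assms], of 1 "-1"]
  by (simp add: bracket_diff_def algebra_simps)

text \<open>Write g y as the commutator of g and y times y g, and split off the commutator, which
  lies in \<open>poly_ker (Suc d)\<close>.\<close>

lemma bracket_diff_poly_ker:
  assumes f: "poly_fun (Suc (Suc d)) f" and y: "y \<in> poly_ker d" and g: "g \<in> carrier G"
  shows "bracket_diff g f y = f (g \<otimes> y \<otimes> inv g \<otimes> inv y) - f \<one>"
proof -
  have yc: "y \<in> carrier G" by (rule poly_ker_carrier[OF y])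
  have "inv g \<otimes> inv y = inv (y \<otimes> g)"
    using g yc by (simp add: inv_mult_group)
  then have "(g \<otimes> y \<otimes> inv g \<otimes> inv y) \<otimes> (y \<otimes> g) = g \<otimes> y"
    using g yc by (simp add: m_assoc)
  with poly_fun_mult_left[OF f poly_ker_commutator[OF y g], of "y \<otimes> g"] g yc show ?thesis
    by (simp add: bracket_diff_def)
qed

text \<open>
  The value of \<open>f\<close>, a polynomial function of degree \<open>d\<close>, at the formal bracket
  \<open>[x\<^sub>1, [x\<^sub>2, \<dots> x\<^sub>d]]\<close> of complex linear combinations \<open>x\<^sub>i\<close> of the elements \<open>\<iota> v\<close>, \<open>v \<in> V\<close>.
\<close>

fun bracket :: "'i set \<Rightarrow> ('i \<Rightarrow> 'a) \<Rightarrow> ('a \<Rightarrow> complex) \<Rightarrow> ('i \<Rightarrow> complex) list \<Rightarrow> complex" where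
  "bracket V \<iota> f [] = 0"
| "bracket V \<iota> f [x] = (\<Sum>v\<in>V. x v * (f (\<iota> v) - f \<one>))"
| "bracket V \<iota> f (x # xs) = (\<Sum>v\<in>V. x v * bracket V \<iota> (bracket_diff (\<iota> v) f) xs)"

lemma bracket_Cons: "xs \<noteq> [] \<Longrightarrow>
    bracket V \<iota> f (x # xs) = (\<Sum>v\<in>V. x v * bracket V \<iota> (bracket_diff (\<iota> v) f) xs)"
  by (cases xs) auto

lemma bracket_lincomb:
  "bracket V \<iota> (\<lambda>k. a * f k + b * g k) xs = a * bracket V \<iota> f xs + b * bracket V \<iota> g xs"
proof (induction xs arbitrary: f g)
  case (Cons x xs)
  show ?case
  proof (cases "xs = []")
    case True
    then show ?thesis
      by (simp add: sum_distrib_left sum.distrib[symmetric] algebra_simps)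
  next
    case False
    have "bracket_diff v (\<lambda>k. a * f k + b * g k)
        = (\<lambda>k. a * bracket_diff v f k + b * bracket_diff v g k)" for v
      by (auto simp: bracket_diff_def algebra_simps)
    then show ?thesis
      by (simp only: bracket_Cons[OF False] Cons.IH distrib_left sum.distrib sum_distrib_left
          mult.left_commute[of _ a] mult.left_commute[of _ b])
  qed
qed simp

lemma bracket_cong:
  "\<iota> ` V \<subseteq> carrier G \<Longrightarrow> (\<And>x. x \<in> carrier G \<Longrightarrow> f x = g x) \<Longrightarrow> bracket V \<iota> f xs = bracket V \<iota> g xs"
proof (induction xs arbitrary: f g)
  case (Cons x xs)
  show ?case
  proof (cases "xs = []")
    case True
    then show ?thesis using Cons.prems by (auto intro!: sum.cong)
  next
    case False
    have "bracket V \<iota> (bracket_diff (\<iota> v) f) xs = bracket V \<iota> (bracket_diff (\<iota> v) g) xs" if "v \<in> V" for v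
      using that Cons.prems by (intro Cons.IH) (auto simp: bracket_diff_def)
    then show ?thesis by (simp add: bracket_Cons[OF False])
  qed
qed simp

text \<open>An iterated bracket of d + 1 vectors lives in \<open>poly_ker d\<close>, so it depends
  only on the restriction of \<open>f\<close> to that subgroup. Each outer entry moves one step down
  the filtration by \<open>poly_ker_commutator\<close>.\<close>

lemma bracket_const_poly_ker:
  assumes V: "\<iota> ` V \<subseteq> carrier G"
  shows "length xs = Suc d \<Longrightarrow> poly_fun (Suc d) f \<Longrightarrow> (\<And>x. x \<in> poly_ker d \<Longrightarrow> f x = f \<one>) \<Longrightarrow>
    bracket V \<iota> f xs = 0"
proof (induction xs arbitrary: d f)
  case (Cons x xs)
  show ?case
  proof (cases d)
    case 0
    then have "x v * (f (\<iota> v) - f \<one>) = 0" if "v \<in> V" for v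
      using Cons.prems(3)[of "\<iota> v"] V that by (auto simp: poly_ker_0)
    then show ?thesis using 0 Cons.prems(1) by (simp del: mult_eq_0_iff)
  next
    case (Suc e)
    then have xs: "xs \<noteq> []" using Cons.prems(1) by auto
    have "bracket V \<iota> (bracket_diff (\<iota> v) f) xs = 0" if "v \<in> V" for v
    proof (rule Cons.IH)
      have v: "\<iota> v \<in> carrier G" using that V by auto
      show "length xs = Suc e" using Cons.prems Suc by simp
      show "poly_fun (Suc e) (bracket_diff (\<iota> v) f)"
        using Cons.prems(2) v unfolding Suc by (rule poly_fun_bracket_diff)
      show "bracket_diff (\<iota> v) f y = bracket_diff (\<iota> v) f \<one>" if "y \<in> poly_ker e" for y
        using bracket_diff_poly_ker[OF Cons.prems(2)[unfolded Suc] that v]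
          Cons.prems(3)[unfolded Suc, OF poly_ker_commutator[OF that v]] v
        by (simp add: bracket_diff_def)
    qed
    then show ?thesis by (simp add: bracket_Cons[OF xs])
  qed
qed simp

lemma bracket_low_degree:
  assumes "\<iota> ` V \<subseteq> carrier G" "length xs = Suc d" "poly_fun d f"
  shows "bracket V \<iota> f xs = 0"
  using assms poly_fun_SucI[OF assms(3)]
  by (intro bracket_const_poly_ker[of _ _ xs d]) (auto simp: poly_ker_def)

lemma bracket_diff_hom:
  assumes \<phi>: "\<phi> \<in> hom G G" and g: "g \<in> carrier G" and k: "k \<in> carrier G"
  shows "bracket_diff g (\<lambda>x. f (\<phi> x)) k = bracket_diff (\<phi> g) f (\<phi> k)"
  using assms by (simp add: bracket_diff_def hom_mult)

text \<open>Products in the group become sums in an outer entry, the error having too low a degree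
  to be seen by the remaining entries.\<close>

lemma bracket_diff_mult_bracket:
  assumes V: "\<iota> ` V \<subseteq> carrier G" and f: "poly_fun (Suc (Suc d)) f" and xs: "length xs = Suc d"
    and g: "g \<in> carrier G" and h: "h \<in> carrier G"
  shows "bracket V \<iota> (bracket_diff (g \<otimes> h) f) xs
    = bracket V \<iota> (bracket_diff g f) xs + bracket V \<iota> (bracket_diff h f) xs"
proof -
  \<comment> \<open>From f(g h k) - f(k g h) = (f(g h k) - f(h k g)) + (f(h k g) - f(k g h)): the
    two summands are bracket differences at h k and at k g, and \<open>?r\<close> collects the
    shifts from there to k.\<close>
  let ?r = "\<lambda>k. (bracket_diff g f (h \<otimes> k) - bracket_diff g f k)
    + (bracket_diff h f (k \<otimes> g) - bracket_diff h f k)"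
  have "poly_fun d ?r"
    using poly_fun_lincomb[OF poly_fun_diff(1)[OF poly_fun_bracket_diff[OF f g] h]
        poly_fun_diff(2)[OF poly_fun_bracket_diff[OF f h] g], of 1 1] by simp
  then have r: "bracket V \<iota> ?r xs = 0"
    by (rule bracket_low_degree[OF V xs])
  have "bracket V \<iota> (bracket_diff (g \<otimes> h) f) xs
    = bracket V \<iota> (\<lambda>k. 1 * (1 * bracket_diff g f k + 1 * bracket_diff h f k) + 1 * ?r k) xs"
    using g h by (intro bracket_cong[OF V]) (simp add: bracket_diff_def m_assoc)
  also have "\<dots> = bracket V \<iota> (bracket_diff g f) xs + bracket V \<iota> (bracket_diff h f) xs"
    by (simp only: bracket_lincomb r) simp
  finally show ?thesis .
qed

text \<open>Finite dimensionality, phrased so that the points of \<open>K\<close> serve as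
  coordinates in \<open>finite_dependence\<close>. A function of degree d + 1 is determined by its
  value at \<open>\<one>\<close> and its differences by the generators, which have degree d.\<close>

lemma poly_fun_determined:
  assumes S: "finite S" "S \<subseteq> carrier G" "generate G S = carrier G"
  shows "\<exists>K. finite K \<and> (\<forall>f. poly_fun d f \<longrightarrow> (\<forall>x\<in>K. f x = 0) \<longrightarrow> (\<forall>x\<in>carrier G. f x = 0))"
proof (induction d)
  case 0
  show ?case by (intro exI[of _ "{\<one>}"]) force
next
  case (Suc d)
  then obtain K where K: "finite K"
    "\<And>f x. poly_fun d f \<Longrightarrow> (\<And>x. x \<in> K \<Longrightarrow> f x = 0) \<Longrightarrow> x \<in> carrier G \<Longrightarrow> f x = 0"
    by blast
  \<comment> \<open>Vanishing on \<open>K\<close> and on the translates s K makes the difference of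
    f by s vanish on \<open>K\<close>.\<close>
  let ?K = "insert \<one> (K \<union> (\<Union>s\<in>S. (\<lambda>k. s \<otimes> k) ` K))"
  have "f g = 0" if f: "poly_fun (Suc d) f" and fK: "\<forall>x\<in>?K. f x = 0" and g: "g \<in> carrier G" for f g
  proof -
    have gen: "f (s \<otimes> k) = f k" if "s \<in> S" "k \<in> carrier G" for s k
      using K(2)[OF poly_fun_diff(1)[OF f], of s k] that S(2) fK by auto
    have "f (h \<otimes> k) = f k" if "h \<in> generate G S" "k \<in> carrier G" for h k
      using that
    proof (induction arbitrary: k rule: generate.induct)
      case one
      then show ?case by simp
    next
      case (incl h)
      then show ?case by (rule gen)
    next
      case (inv h)
      then have "h \<in> carrier G" using S by auto
      with inv gen[of h "inv h \<otimes> k"] show ?case by (simp flip: m_assoc)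
    next
      case (eng h1 h2)
      then have "h1 \<in> carrier G" "h2 \<in> carrier G" using S(3) by auto
      with eng show ?case by (simp add: m_assoc)
    qed
    from this[of g \<one>] g S(3) fK show ?thesis by simp
  qed
  moreover have "finite ?K" using K(1) S(1) by simp
  ultimately show ?case by blast
qed

section \<open>Invariant functionals and twisted conjugacy classes\<close>

lemma poly_fun_orbit_poly:
  assumes \<phi>: "\<phi> \<in> hom G G"
  shows "poly_fun d f \<Longrightarrow> poly_fun d (orbit_poly \<phi> p f)"
proof (induction p rule: pCons_induct)
  case 0
  then show ?case using poly_fun_const[of d 0] by (simp add: orbit_poly_0 cong: poly_fun_cong)
next
  case (pCons a p)
  then have "poly_fun d (\<lambda>x. a * f x + 1 * orbit_poly \<phi> p f (\<phi> x))"
    by (intro poly_fun_lincomb poly_fun_hom[OF \<phi>])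
  then show ?case by (simp add: orbit_poly_pCons cong: poly_fun_cong)
qed

text \<open>\<open>h\<close> minus its value at \<open>\<one>\<close> induces a nonzero
  \<phi>-invariant homomorphism from the quotient of \<open>poly_ker d\<close> by
  \<open>poly_ker (Suc d)\<close> to the complex numbers.\<close>

definition fixed_poly_fun :: "('a \<Rightarrow> 'a) \<Rightarrow> nat \<Rightarrow> ('a \<Rightarrow> complex) \<Rightarrow> bool" where
  "fixed_poly_fun \<phi> d h \<longleftrightarrow> poly_fun (Suc d) h \<and> (\<forall>x\<in>poly_ker d. h (\<phi> x) = h x) \<and>
     (\<exists>x\<in>poly_ker d. h x \<noteq> h \<one>)"

text \<open>
  In the finite-dimensional space of polynomial functions modulo those constant on \<^term>\<open>poly_ker d\<close>,
  the polynomial annihilating \<open>f\<close> under \<open>\<phi>\<close> must vanish at \<open>1\<close>, as \<open>\<theta>\<close> maps \<open>p(\<phi>) f\<close> to \<open>p(1) \<theta>(f)\<close>.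
\<close>

lemma fixed_poly_fun_exists:
  assumes S: "finite S" "S \<subseteq> carrier G" "generate G S = carrier G"
    and \<phi>: "\<phi> \<in> hom G G" and f: "poly_fun (Suc d) f"
    and lin: "\<And>a b f g. \<theta> (\<lambda>x. a * f x + b * g x) = a * \<theta> f + b * \<theta> g"
    and van: "\<And>h. poly_fun (Suc d) h \<Longrightarrow> (\<And>x. x \<in> poly_ker d \<Longrightarrow> h x = h \<one>) \<Longrightarrow> \<theta> h = 0"
    and inv: "\<And>h. poly_fun (Suc d) h \<Longrightarrow> \<theta> (\<lambda>x. h (\<phi> x)) = \<theta> h"
    and nz: "\<theta> f \<noteq> (0::complex)"
  shows "\<exists>h. fixed_poly_fun \<phi> d h"
proof -
  have \<phi>1: "\<phi> \<one> = \<one>" using hom_one[OF \<phi>] is_group by simp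
  have \<theta>0: "\<theta> (\<lambda>x. 0) = 0" using lin[of 0 "\<lambda>x. 0" 0 "\<lambda>x. 0"] by simp
  obtain K where K: "finite K" "\<And>f x. poly_fun (Suc d) f \<Longrightarrow> (\<And>x. x \<in> K \<Longrightarrow> f x = 0) \<Longrightarrow>
      x \<in> carrier G \<Longrightarrow> f x = 0"
    using poly_fun_determined[OF S, of "Suc d"] by blast
  \<comment> \<open>These are \<open>card K + 1\<close> iterates of f, compared on
    \<open>card K\<close> points.\<close>
  obtain c where c: "\<exists>i\<in>{..card K}. c i \<noteq> 0"
    "\<forall>x\<in>K. (\<Sum>i\<in>{..card K}. c i * f ((\<phi> ^^ i) x)) = 0"
    using finite_dependence[of K "{..card K}" "\<lambda>i x. f ((\<phi> ^^ i) x)"] K(1) by auto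
  define p where "p = (\<Sum>i\<le>card K. monom (c i) i)"
  have cp: "coeff p i = (if i \<le> card K then c i else 0)" for i
    by (simp add: p_def coeff_sum)
  have p0: "p \<noteq> 0" using c(1) cp by (metis atMost_iff coeff_0)
  have degp: "degree p \<le> card K" by (intro degree_le) (simp add: cp)
  have "orbit_poly \<phi> p f x = 0" if "x \<in> K" for x
    using c(2) that by (simp add: orbit_poly_bound[OF degp] cp)
  then have p_zero: "orbit_poly \<phi> p f x = 0" if "x \<in> carrier G" for x
    using K(2)[OF poly_fun_orbit_poly[OF \<phi> f]] that by blast
  obtain r where r: "p = [:- 1, 1:] ^ Polynomial.order 1 p * r" "\<not> [:- 1, 1:] dvd r"
    using order_decomp[OF p0] by blast
  have \<theta>_poly: "\<theta> (orbit_poly \<phi> q f) = poly q 1 * \<theta> f" for q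
  proof (induction q rule: pCons_induct)
    case 0
    then show ?case using \<theta>0 by (simp add: orbit_poly_def[abs_def])
  next
    case (pCons a q)
    have "\<theta> (orbit_poly \<phi> (pCons a q) f) = \<theta> (\<lambda>x. a * f x + 1 * orbit_poly \<phi> q f (\<phi> x))"
      by (rule arg_cong[of _ _ \<theta>]) (auto simp: orbit_poly_pCons)
    also have "\<dots> = a * \<theta> f + \<theta> (orbit_poly \<phi> q f)"
      using inv[OF poly_fun_orbit_poly[OF \<phi> f, of q]] by (simp only: lin) simp
    finally show ?case using pCons.IH by (simp add: distrib_right)
  qed
  \<comment> \<open>Applying X - 1 leads from \<open>u j\<close> to \<open>u (Suc j)\<close>. The
    chain starts at r(T) f, on which \<theta> is nonzero because r(1) is, and ends at p(T) f = 0.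
    Its last member not constant on \<open>poly_ker d\<close> is the required function.\<close>
  define u where "u = (\<lambda>j. orbit_poly \<phi> ([:- 1, 1:] ^ j * r) f)"
  define bad where "bad = (\<lambda>j. \<forall>x\<in>poly_ker d. u j x = u j \<one>)"
  have u: "poly_fun (Suc d) (u j)" for j
    unfolding u_def by (rule poly_fun_orbit_poly[OF \<phi> f])
  have "poly r 1 \<noteq> 0" using r(2) by (simp add: poly_eq_0_iff_dvd)
  then have "\<theta> (u 0) \<noteq> 0" by (simp add: u_def \<theta>_poly nz)
  then have "\<not> bad 0" using van[OF u, of 0] by (auto simp: bad_def)
  moreover have "bad (Polynomial.order 1 p)"
    using p_zero poly_ker_carrier by (simp add: bad_def u_def flip: r(1))
  ultimately obtain j where j: "\<not> bad j" "bad (Suc j)"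
    using nat_induct[of "\<lambda>j. \<not> bad j" "Polynomial.order 1 p"] by blast
  have "u (Suc j) x = u j (\<phi> x) - u j x" for x
    using orbit_poly_root[of \<phi> 1 "[:- 1, 1:] ^ j * r" f x]
    by (simp only: u_def power_Suc mult.assoc) simp
  \<comment> \<open>The constant value of \<open>u (Suc j)\<close> is its value at
    \<open>\<one>\<close>, which is 0 as \<phi> fixes \<open>\<one>\<close>.\<close>
  with j(2) have "u j (\<phi> x) = u j x" if "x \<in> poly_ker d" for x
    using that \<phi>1 by (auto simp: bad_def)
  with j(1) u[of j] show ?thesis unfolding fixed_poly_fun_def bad_def by blast
qed

theorem infinite_twisted_classes:
  assumes S: "finite S" "S \<subseteq> carrier G" "generate G S = carrier G"
    and \<phi>: "\<phi> \<in> hom G G" and ex: "fixed_poly_fun \<phi> d0 h0"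
  shows "infinite (carrier G // twisted_conj G \<phi>)"
proof -
  define d where "d = (LEAST d. \<exists>h. fixed_poly_fun \<phi> d h)"
  have "\<exists>d h. fixed_poly_fun \<phi> d h" using ex by (intro exI)
  then have "\<exists>h. fixed_poly_fun \<phi> d h" unfolding d_def by (rule LeastI_ex)
  then obtain h where h: "poly_fun (Suc d) h" "\<And>x. x \<in> poly_ker d \<Longrightarrow> h (\<phi> x) = h x"
    and nc: "\<exists>x\<in>poly_ker d. h x \<noteq> h \<one>"
    unfolding fixed_poly_fun_def by blast
  have no_fixed: "\<not> fixed_poly_fun \<phi> j f" if "j < d" for j f
    using not_less_Least[OF that[unfolded d_def]] by blast
  \<comment> \<open>Otherwise evaluation at g, normalised at \<open>\<one>\<close>, would be a
    nonzero invariant functional at level j, against the minimality of d.\<close>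
  have step: "g \<in> poly_ker (Suc j)"
    if j: "j < d" and g: "g \<in> poly_ker j" and z: "\<phi> g \<otimes> inv g \<in> poly_ker (Suc j)" for j g
  proof (rule poly_kerI[OF poly_ker_carrier[OF g]])
    have gc: "g \<in> carrier G" "\<phi> g \<in> carrier G"
      using poly_ker_carrier[OF g] \<phi> by (auto simp: hom_in_carrier)
    fix f assume f: "poly_fun (Suc j) f"
    let ?\<theta> = "\<lambda>f :: 'a \<Rightarrow> complex. f g - f \<one>"
    have inv: "?\<theta> (\<lambda>x. f (\<phi> x)) = ?\<theta> f" if f: "poly_fun (Suc j) f" for f
    proof -
      have z': "\<phi> g \<otimes> inv g \<in> poly_ker j"
        using z poly_ker_antimono[of j "Suc j"] by auto
      have "f (\<phi> g \<otimes> inv g \<otimes> g) = f (\<phi> g \<otimes> inv g) + f g - f \<one>"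
        by (rule poly_fun_mult_left[OF f z' gc(1)])
      moreover have "f (\<phi> g \<otimes> inv g) = f \<one>" by (rule poly_kerD[OF z f])
      moreover have "\<phi> \<one> = \<one>" using hom_one[OF \<phi>] is_group by simp
      ultimately show ?thesis using gc by (simp add: m_assoc)
    qed
    show "f g = f \<one>"
    proof (rule ccontr)
      assume "f g \<noteq> f \<one>"
      then have "\<exists>h. fixed_poly_fun \<phi> j h"
        using g by (intro fixed_poly_fun_exists[OF S \<phi> f, of ?\<theta>] inv) (auto simp: algebra_simps)
      with no_fixed[OF j] show False by blast
    qed
  qed
  have sep: "h k = h l"
    if k: "k \<in> poly_ker d" and l: "l \<in> poly_ker d" and kl: "(k, l) \<in> twisted_conj G \<phi>" for k l
  proof -
    obtain g where g: "g \<in> carrier G" "k = g \<otimes> l \<otimes> inv (\<phi> g)"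
      using kl unfolding twisted_conj_def by auto
    have gc: "\<phi> g \<in> carrier G" "l \<in> carrier G" "k \<in> carrier G"
      using \<phi> g poly_ker_carrier[OF l] poly_ker_carrier[OF k] by (auto simp: hom_in_carrier)
    have eq: "k \<otimes> \<phi> g = g \<otimes> l"
      using g gc by (simp add: m_assoc)
    have "\<phi> g = inv k \<otimes> (g \<otimes> l)"
      using eq g gc by (simp add: inv_solve_left)
    then have "\<phi> g \<otimes> inv g = inv k \<otimes> (g \<otimes> l \<otimes> inv g)"
      using g(1) gc by (simp add: m_assoc)
    then have z: "\<phi> g \<otimes> inv g \<in> poly_ker d"
      using poly_ker_mult[OF poly_ker_inv[OF k] poly_ker_conj[OF l g(1)]] by simp
    \<comment> \<open>Since g is fixed modulo \<open>poly_ker d\<close>, it climbs the filtration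
      one level at a time.\<close>
    have "j \<le> d \<Longrightarrow> g \<in> poly_ker j" for j
    proof (induction j)
      case 0
      then show ?case using g by (simp add: poly_ker_0)
    next
      case (Suc j)
      then show ?case using step[of j g] z poly_ker_antimono[of "Suc j" d] by auto
    qed
    then have gd: "g \<in> poly_ker d" by simp
    have "h (k \<otimes> \<phi> g) = h k + h (\<phi> g) - h \<one>"
      by (rule poly_fun_mult_left[OF h(1) k gc(1)])
    moreover have "h (g \<otimes> l) = h g + h l - h \<one>"
      by (rule poly_fun_mult_left[OF h(1) gd gc(2)])
    ultimately show ?thesis using eq h(2)[OF gd] by simp
  qed
  obtain x where x: "x \<in> poly_ker d" "h x \<noteq> h \<one>" using nc by blast
  note pow = poly_fun_pow[OF h(1) x(1)]
  let ?c = "\<lambda>n::nat. twisted_conj G \<phi> `` {x [^] n}"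
  have refl: "(y, y) \<in> twisted_conj G \<phi>" if "y \<in> carrier G" for y
  proof -
    have "\<phi> \<one> = \<one>" using hom_one[OF \<phi>] is_group by simp
    with that show ?thesis unfolding twisted_conj_def by (auto intro!: bexI[of _ \<one>])
  qed
  have "inj ?c"
  proof (rule injI)
    fix m n assume "?c m = ?c n"
    moreover have "x [^] n \<in> ?c n" using refl poly_ker_carrier x(1) by auto
    ultimately have "(x [^] m, x [^] n) \<in> twisted_conj G \<phi>" by auto
    then have "h (x [^] m) = h (x [^] n)" using sep pow by blast
    then have "of_nat m * (h x - h \<one>) = of_nat n * (h x - h \<one>)"
      using pow[of m] pow[of n] by metis
    then show "m = n" using x(2) by simp
  qed
  then have "infinite (range ?c)" by (rule range_inj_infinite)
  moreover have "range ?c \<subseteq> carrier G // twisted_conj G \<phi>"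
    using poly_ker_carrier[OF x(1)] by (auto intro: quotientI)
  ultimately show ?thesis by (meson finite_subset)
qed

end

section \<open>Groups with coordinates\<close>

text \<open>A pairing with an alternating matrix sees x and y only through their 2 by 2 minors, and
  here only through those at non-adjacent pairs. Exchanging the summation indices brings out the
  minors at the cost of a factor 2.\<close>

lemma alternating_sum_eq:
  fixes D :: "'v \<Rightarrow> 'v \<Rightarrow> complex"
  assumes V: "finite V"
    and anti: "\<And>u v. u \<in> V \<Longrightarrow> v \<in> V \<Longrightarrow> D u v = - D v u"
    and zero: "\<And>u v. u \<in> V \<Longrightarrow> v \<in> V \<Longrightarrow> adj u v \<Longrightarrow> D u v = 0"
    and eq: "\<And>u v. u \<in> V \<Longrightarrow> v \<in> V \<Longrightarrow> u \<noteq> v \<Longrightarrow> \<not> adj u v \<Longrightarrow>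
      x u * y v - x v * y u = c * (x' u * y' v - x' v * y' u)"
  shows "(\<Sum>u\<in>V. \<Sum>v\<in>V. x u * (y v * D u v)) = c * (\<Sum>u\<in>V. \<Sum>v\<in>V. x' u * (y' v * D u v))"
proof -
  have wedge: "2 * (\<Sum>u\<in>V. \<Sum>v\<in>V. x u * (y v * D u v))
      = (\<Sum>u\<in>V. \<Sum>v\<in>V. (x u * y v - x v * y u) * D u v)" for x y :: "'v \<Rightarrow> complex"
  proof -
    have "(\<Sum>u\<in>V. \<Sum>v\<in>V. x u * (y v * D u v)) = (\<Sum>u\<in>V. \<Sum>v\<in>V. x v * (y u * D v u))"
      by (rule sum.swap)
    also have "\<dots> = (\<Sum>u\<in>V. \<Sum>v\<in>V. - (x v * y u * D u v))"
    proof (intro sum.cong HOL.refl)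
      fix u v assume "u \<in> V" "v \<in> V"
      then show "x v * (y u * D v u) = - (x v * y u * D u v)" using anti[of u v] by simp
    qed
    finally have "2 * (\<Sum>u\<in>V. \<Sum>v\<in>V. x u * (y v * D u v))
        = (\<Sum>u\<in>V. \<Sum>v\<in>V. x u * (y v * D u v)) + (\<Sum>u\<in>V. \<Sum>v\<in>V. - (x v * y u * D u v))"
      by simp
    also have "\<dots> = (\<Sum>u\<in>V. \<Sum>v\<in>V. (x u * y v - x v * y u) * D u v)"
      unfolding sum.distrib[symmetric] by (intro sum.cong HOL.refl) (simp add: algebra_simps)
    finally show ?thesis .
  qed
  have key: "(x u * y v - x v * y u) * D u v = c * ((x' u * y' v - x' v * y' u) * D u v)"
    if "u \<in> V" "v \<in> V" for u v
  proof (cases "u = v \<or> adj u v")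
    case True
    then have "D u v = 0" using anti[of u u] zero[of u v] that by auto
    then show ?thesis by simp
  next
    case False
    then show ?thesis using eq[of u v] that by simp
  qed
  have "2 * (\<Sum>u\<in>V. \<Sum>v\<in>V. x u * (y v * D u v))
      = (\<Sum>u\<in>V. \<Sum>v\<in>V. c * ((x' u * y' v - x' v * y' u) * D u v))"
    unfolding wedge by (intro sum.cong HOL.refl key)
  also have "\<dots> = c * (2 * (\<Sum>u\<in>V. \<Sum>v\<in>V. x' u * (y' v * D u v)))"
    unfolding wedge by (simp add: sum_distrib_left)
  finally show ?thesis by simp
qed

text \<open>Each difference of an exponential gains a factor \<open>fps_X\<close>, which is what
  lowers degrees; the constant term of the cofactor is the contribution that survives in lowest
  order.\<close>

lemma fps_exp_minus_1: "\<exists>U. fps_exp (a::complex) - 1 = fps_X * U \<and> fps_nth U 0 = a"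
proof (intro exI conjI)
  show "fps_exp a - 1 = fps_X * Abs_fps (\<lambda>n. fps_nth (fps_exp a) (Suc n))"
  proof (rule fps_ext)
    fix n show "fps_nth (fps_exp a - 1) n
        = fps_nth (fps_X * Abs_fps (\<lambda>n. fps_nth (fps_exp a) (Suc n))) n"
      by (cases n) (simp_all del: fps_exp_nth, simp)
  qed
qed simp

text \<open>The abelianisation is free on the images of \<open>\<iota> v\<close>, and
  \<open>\<chi> w\<close> is the exponent sum of the generator w.\<close>

locale coordinate_group = group G for G (structure) +
  fixes V :: "'v set" and \<iota> :: "'v \<Rightarrow> 'a" and \<chi> :: "'v \<Rightarrow> 'a \<Rightarrow> int"
  assumes finite_V: "finite V"
    and \<iota>_carrier: "v \<in> V \<Longrightarrow> \<iota> v \<in> carrier G"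
    and generate_\<iota>: "generate G (\<iota> ` V) = carrier G"
    and \<chi>_mult: "w \<in> V \<Longrightarrow> g \<in> carrier G \<Longrightarrow> h \<in> carrier G \<Longrightarrow> \<chi> w (g \<otimes> h) = \<chi> w g + \<chi> w h"
    and \<chi>_\<iota>: "v \<in> V \<Longrightarrow> w \<in> V \<Longrightarrow> \<chi> w (\<iota> v) = (if v = w then 1 else 0)"
begin

lemma \<iota>_image: "\<iota> ` V \<subseteq> carrier G"
  using \<iota>_carrier by auto

text \<open>A homomorphism to the complex numbers is determined on generators, where both sides
  agree.\<close>

lemma additive_expand:
  fixes c :: "'a \<Rightarrow> complex"
  assumes c: "\<And>g h. g \<in> carrier G \<Longrightarrow> h \<in> carrier G \<Longrightarrow> c (g \<otimes> h) = c g + c h"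
    and g: "g \<in> carrier G"
  shows "c g = (\<Sum>w\<in>V. of_int (\<chi> w g) * c (\<iota> w))"
proof -
  have c1: "c \<one> = 0" using c[of \<one> \<one>] by simp
  have \<chi>1: "\<chi> w \<one> = 0" if "w \<in> V" for w using \<chi>_mult[of w \<one> \<one>] that by simp
  have cinv: "c (inv h) = - c h" if "h \<in> carrier G" for h
    using c[of h "inv h"] that c1 by (simp add: add_eq_0_iff)
  have \<chi>inv: "\<chi> w (inv h) = - \<chi> w h" if "w \<in> V" "h \<in> carrier G" for w h
    using \<chi>_mult[of w h "inv h"] that \<chi>1 by simp
  have base: "c (\<iota> v) = (\<Sum>w\<in>V. of_int (\<chi> w (\<iota> v)) * c (\<iota> w))" if "v \<in> V" for v
  proof -
    have "(\<Sum>w\<in>V. of_int (\<chi> w (\<iota> v)) * c (\<iota> w)) = (\<Sum>w\<in>V. if v = w then c (\<iota> w) else 0)"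
      using \<chi>_\<iota>[OF that] by (intro sum.cong) auto
    then show ?thesis using that finite_V by simp
  qed
  have "g \<in> generate G (\<iota> ` V)" using g generate_\<iota> by simp
  then show ?thesis
  proof (induction rule: generate.induct)
    case one
    then show ?case using \<chi>1 c1 by simp
  next
    case (incl h)
    then obtain v where "v \<in> V" "h = \<iota> v" by auto
    then show ?case using base by (simp only:)
  next
    case (inv h)
    then obtain v where v: "v \<in> V" "h = \<iota> v" by auto
    then show ?case
      using base[OF v(1)] \<iota>_carrier[OF v(1)] by (simp add: cinv \<chi>inv sum_negf)
  next
    case (eng g h)
    then have "g \<in> carrier G" "h \<in> carrier G" using generate_\<iota> by auto
    then show ?case
      using eng.IH by (simp add: c \<chi>_mult distrib_right sum.distrib)
  qed
qed

end

text \<open>In \<open>cocycle_exists\<close>, q is the translation part of an affine action whose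
  linear part is an exponential. The condition on edges is the infinitesimal form of commutation of
  adjacent generators.\<close>

locale raag_coordinates = coordinate_group G V \<iota> \<chi>
  for G (structure) and V :: "'v set" and \<iota> :: "'v \<Rightarrow> 'a" and \<chi> :: "'v \<Rightarrow> 'a \<Rightarrow> int" +
  fixes adj :: "'v \<Rightarrow> 'v \<Rightarrow> bool"
  assumes adj_sym: "adj v w \<Longrightarrow> adj w v"
    and adj_irrefl: "\<not> adj v v"
    and adj_commute: "v \<in> V \<Longrightarrow> w \<in> V \<Longrightarrow> adj v w \<Longrightarrow> \<iota> v \<otimes> \<iota> w = \<iota> w \<otimes> \<iota> v"
    and cocycle_exists: "(\<And>v w. v \<in> V \<Longrightarrow> w \<in> V \<Longrightarrow> adj v w \<Longrightarrow> l v * t w = l w * t v) \<Longrightarrow>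
      \<exists>q. (\<forall>g\<in>carrier G. \<forall>h\<in>carrier G.
            q (g \<otimes> h) = q g + fps_exp (\<Sum>v\<in>V. l v * complex_of_int (\<chi> v g)) * q h) \<and>
          (\<forall>v\<in>V. fps_nth (q (\<iota> v)) 0 = t v)"
begin

definition act :: "('a \<Rightarrow> 'a) \<Rightarrow> ('v \<Rightarrow> complex) \<Rightarrow> 'v \<Rightarrow> complex" where
  "act \<phi> x = (\<lambda>w. \<Sum>v\<in>V. of_int (\<chi> w (\<phi> (\<iota> v))) * x v)"

text \<open>Naturality, one entry at a time: every entry enters additively, so the image of a
  generator under \<phi> may be replaced by its expansion in the abelianisation.\<close>

lemma bracket_hom:
  assumes \<phi>: "\<phi> \<in> hom G G"
  shows "poly_fun d f \<Longrightarrow> length xs = d \<Longrightarrow>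
    bracket V \<iota> (\<lambda>x. f (\<phi> x)) xs = bracket V \<iota> f (map (act \<phi>) xs)"
proof (induction xs arbitrary: d f)
  case (Cons x xs)
  have \<phi>1: "\<phi> \<one> = \<one>" using hom_one[OF \<phi>] is_group by simp
  have \<phi>\<iota>: "\<phi> (\<iota> v) \<in> carrier G" if "v \<in> V" for v
    using hom_in_carrier[OF \<phi> \<iota>_carrier[OF that]] .
  have swap: "(\<Sum>v\<in>V. x v * c (\<phi> (\<iota> v))) = (\<Sum>w\<in>V. act \<phi> x w * c (\<iota> w))"
    if c: "\<And>g h. g \<in> carrier G \<Longrightarrow> h \<in> carrier G \<Longrightarrow> c (g \<otimes> h) = c g + c h" for c :: "'a \<Rightarrow> complex"
  proof -
    have "(\<Sum>v\<in>V. x v * c (\<phi> (\<iota> v)))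
        = (\<Sum>v\<in>V. \<Sum>w\<in>V. of_int (\<chi> w (\<phi> (\<iota> v))) * x v * c (\<iota> w))"
    proof (intro sum.cong HOL.refl)
      fix v assume "v \<in> V"
      then have "c (\<phi> (\<iota> v)) = (\<Sum>w\<in>V. of_int (\<chi> w (\<phi> (\<iota> v))) * c (\<iota> w))"
        using c \<phi>\<iota> by (intro additive_expand)
      then show "x v * c (\<phi> (\<iota> v)) = (\<Sum>w\<in>V. of_int (\<chi> w (\<phi> (\<iota> v))) * x v * c (\<iota> w))"
        by (simp add: sum_distrib_left mult_ac)
    qed
    also have "\<dots> = (\<Sum>w\<in>V. \<Sum>v\<in>V. of_int (\<chi> w (\<phi> (\<iota> v))) * x v * c (\<iota> w))"
      by (rule sum.swap)
    finally show ?thesis by (simp add: act_def sum_distrib_right)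
  qed
  show ?case
  proof (cases "xs = []")
    case True
    then have d: "poly_fun (Suc 0) f" using Cons.prems by simp
    have "f (g \<otimes> h) - f \<one> = (f g - f \<one>) + (f h - f \<one>)" if "g \<in> carrier G" "h \<in> carrier G" for g h
      using poly_fun_mult_left[OF d, of g h] that by (simp add: poly_ker_0)
    from swap[of "\<lambda>g. f g - f \<one>", OF this] show ?thesis using True \<phi>1 by simp
  next
    case False
    then obtain e where e: "d = Suc (Suc e)" "length xs = Suc e"
      using Cons.prems(2) by (cases xs) auto
    have f: "poly_fun (Suc (Suc e)) f" using Cons.prems(1) e by simp
    let ?ys = "map (act \<phi>) xs"
    have "bracket V \<iota> (bracket_diff (\<iota> v) (\<lambda>x. f (\<phi> x))) xs
        = bracket V \<iota> (bracket_diff (\<phi> (\<iota> v)) f) ?ys" if v: "v \<in> V" for v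
    proof -
      have "bracket V \<iota> (bracket_diff (\<iota> v) (\<lambda>x. f (\<phi> x))) xs
          = bracket V \<iota> (\<lambda>k. bracket_diff (\<phi> (\<iota> v)) f (\<phi> k)) xs"
        by (intro bracket_cong \<iota>_image bracket_diff_hom[OF \<phi> \<iota>_carrier[OF v]])
      also have "\<dots> = bracket V \<iota> (bracket_diff (\<phi> (\<iota> v)) f) ?ys"
        by (rule Cons.IH[OF poly_fun_bracket_diff[OF f \<phi>\<iota>[OF v]] e(2)])
      finally show ?thesis .
    qed
    then have "bracket V \<iota> (\<lambda>x. f (\<phi> x)) (x # xs)
        = (\<Sum>v\<in>V. x v * bracket V \<iota> (bracket_diff (\<phi> (\<iota> v)) f) ?ys)"
      by (simp add: bracket_Cons[OF False])
    also have "\<dots> = (\<Sum>w\<in>V. act \<phi> x w * bracket V \<iota> (bracket_diff (\<iota> w) f) ?ys)"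
      using e by (intro swap[of "\<lambda>g. bracket V \<iota> (bracket_diff g f) ?ys"]
        bracket_diff_mult_bracket[OF \<iota>_image f]) auto
    also have "\<dots> = bracket V \<iota> f (map (act \<phi>) (x # xs))"
      using False by (simp add: bracket_Cons)
    finally show ?thesis .
  qed
qed simp

text \<open>The innermost bracket only sees minors at non-adjacent pairs, because adjacent
  generators commute.\<close>

lemma bracket_append_wedge:
  assumes eq: "\<And>u v. u \<in> V \<Longrightarrow> v \<in> V \<Longrightarrow> u \<noteq> v \<Longrightarrow> \<not> adj u v \<Longrightarrow>
      a u * b v - a v * b u = c * (a' u * b' v - a' v * b' u)"
  shows "bracket V \<iota> f (xs @ [a, b]) = c * bracket V \<iota> f (xs @ [a', b'])"
proof (induction xs arbitrary: f)
  case Nil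
  define D where "D = (\<lambda>v w. f (\<iota> v \<otimes> \<iota> w) - f (\<iota> w \<otimes> \<iota> v))"
  have br: "bracket V \<iota> f [a, b] = (\<Sum>v\<in>V. \<Sum>w\<in>V. a v * (b w * D v w))" for a b
    using \<iota>_carrier by (simp add: bracket_diff_def D_def sum_distrib_left)
  show ?case
    unfolding append_Nil br
  proof (rule alternating_sum_eq[OF finite_V _ _ eq])
    fix v w assume "v \<in> V" "w \<in> V" "adj v w"
    then show "D v w = 0" using adj_commute[of v w] by (simp add: D_def)
  qed (simp_all add: D_def)
next
  case (Cons x xs)
  have ne: "xs @ [a, b] \<noteq> []" "xs @ [a', b'] \<noteq> []" by simp_all
  show ?case
    unfolding append_Cons bracket_Cons[OF ne(1)] bracket_Cons[OF ne(2)] Cons.IH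
    by (simp add: sum_distrib_left mult_ac)
qed

lemma bracket_append_scale:
  "(\<And>a v. a \<in> set as \<Longrightarrow> v \<in> V \<Longrightarrow> Y a v = a * X a v) \<Longrightarrow> ys \<noteq> [] \<Longrightarrow>
    bracket V \<iota> f (map Y as @ ys) = prod_list as * bracket V \<iota> f (map X as @ ys)"
  by (induction as arbitrary: f) (simp_all add: bracket_Cons sum_distrib_left mult_ac)

section \<open>Affine cocycles as polynomial functions, and their values on brackets\<close>

definition lin :: "('v \<Rightarrow> complex) \<Rightarrow> ('v \<Rightarrow> complex) \<Rightarrow> complex" where
  "lin l x = (\<Sum>v\<in>V. x v * l v)"

text \<open>A difference multiplies by \<open>fps_exp (lam h) - 1\<close>, a multiple of
  \<open>fps_X\<close>, and so passes to the preceding coefficient. The arbitrary factor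
  \<open>A\<close> absorbs the cofactor in the induction.\<close>

lemma cocycle_poly_fun:
  assumes q: "\<And>g h. g \<in> carrier G \<Longrightarrow> h \<in> carrier G \<Longrightarrow> q (g \<otimes> h) = q g + fps_exp (lam g) * q h"
    and lam: "\<And>g h. g \<in> carrier G \<Longrightarrow> h \<in> carrier G \<Longrightarrow> lam (g \<otimes> h) = lam g + lam h"
  shows "poly_fun n (\<lambda>k. fps_nth (A * fps_exp (lam k)) n)"
    and "poly_fun (Suc n) (\<lambda>k. fps_nth (A * q k) n)"
proof -
  have E: "poly_fun n (\<lambda>k. fps_nth (A * fps_exp (lam k)) n)" for n A
  proof (induction n arbitrary: A)
    case 0
    show ?case by auto
  next
    case (Suc n)
    have "poly_fun n (\<lambda>k. fps_nth (A * fps_exp (lam (h \<otimes> k))) (Suc n) - fps_nth (A * fps_exp (lam k)) (Suc n))"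
      "poly_fun n (\<lambda>k. fps_nth (A * fps_exp (lam (k \<otimes> h))) (Suc n) - fps_nth (A * fps_exp (lam k)) (Suc n))"
      if h: "h \<in> carrier G" for h
    proof -
      obtain U where U: "fps_exp (lam h) - 1 = fps_X * U" using fps_exp_minus_1 by blast
      have "fps_nth (A * (fps_exp (lam h) * fps_exp (lam k))) (Suc n) - fps_nth (A * fps_exp (lam k)) (Suc n)
          = fps_nth ((A * U) * fps_exp (lam k)) n" for k
      proof -
        have "A * (fps_exp (lam h) * fps_exp (lam k)) - A * fps_exp (lam k)
            = (fps_exp (lam h) - 1) * (A * fps_exp (lam k))"
          by (simp add: algebra_simps)
        also have "\<dots> = fps_X * (A * U * fps_exp (lam k))" by (simp add: U mult_ac)
        finally show ?thesis by (simp flip: fps_sub_nth)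
      qed
      then show "poly_fun n (\<lambda>k. fps_nth (A * fps_exp (lam (h \<otimes> k))) (Suc n) - fps_nth (A * fps_exp (lam k)) (Suc n))"
        "poly_fun n (\<lambda>k. fps_nth (A * fps_exp (lam (k \<otimes> h))) (Suc n) - fps_nth (A * fps_exp (lam k)) (Suc n))"
        using Suc.IH[of "A * U"] h
        by (simp_all add: lam fps_exp_add_mult add.commute[of "lam _" "lam h"] cong: poly_fun_cong)
    qed
    then show ?case by simp
  qed
  show "poly_fun n (\<lambda>k. fps_nth (A * fps_exp (lam k)) n)" by (rule E)
  show "poly_fun (Suc n) (\<lambda>k. fps_nth (A * q k) n)"
  proof (induction n arbitrary: A)
    case 0
    have "poly_fun 0 (\<lambda>k. fps_nth (A * q (h \<otimes> k)) 0 - fps_nth (A * q k) 0)"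
      "poly_fun 0 (\<lambda>k. fps_nth (A * q (k \<otimes> h)) 0 - fps_nth (A * q k) 0)" if "h \<in> carrier G" for h
      using that by (auto simp: q algebra_simps intro!: exI[of _ "fps_nth A 0 * fps_nth (q h) 0"])
    then show ?case by simp
  next
    case (Suc n)
    have "poly_fun (Suc n) (\<lambda>k. fps_nth (A * q (h \<otimes> k)) (Suc n) - fps_nth (A * q k) (Suc n))"
      if h: "h \<in> carrier G" for h
    proof -
      obtain U where U: "fps_exp (lam h) - 1 = fps_X * U" using fps_exp_minus_1 by blast
      have "fps_nth (A * (q h + fps_exp (lam h) * q k)) (Suc n) - fps_nth (A * q k) (Suc n)
          = 1 * fps_nth ((A * U) * q k) n + 1 * fps_nth (A * q h) (Suc n)" for k
      proof -
        have "A * (q h + fps_exp (lam h) * q k) - A * q k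
            = (fps_exp (lam h) - 1) * (A * q k) + A * q h"
          by (simp add: algebra_simps)
        also have "\<dots> = fps_X * (A * U * q k) + A * q h" by (simp add: U mult_ac)
        finally show ?thesis by (simp flip: fps_sub_nth)
      qed
      then show ?thesis
        using poly_fun_lincomb[OF Suc.IH[of "A * U"] poly_fun_const[of "Suc n" "fps_nth (A * q h) (Suc n)"], of 1 1] h
        by (simp add: q cong: poly_fun_cong del: poly_fun.simps)
    qed
    \<comment> \<open>On this side the difference of q is \<open>fps_exp (lam k) * q h\<close>,
      which is covered by the exponential case.\<close>
    moreover have "poly_fun (Suc n) (\<lambda>k. fps_nth (A * q (k \<otimes> h)) (Suc n) - fps_nth (A * q k) (Suc n))"
      if h: "h \<in> carrier G" for h
      using E[of "Suc n" "A * q h"] h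
      by (simp add: q ring_distribs mult_ac cong: poly_fun_cong del: poly_fun.simps)
    ultimately show ?case unfolding poly_fun.simps(2)[of "Suc n"] by blast
  qed
qed

text \<open>The functions A q + B (exp lam - 1) are closed under \<open>bracket_diff\<close>: A is
  multiplied by exp(lam g) - 1, and B is replaced by - A q(g), the old B dropping out since lam is
  additive. Thus every outer entry contributes one factor \<open>fps_X\<close> and one value of
  \<open>lin l\<close>, while the innermost pair contributes a determinant, one half of which comes
  from the B of the last step.\<close>

lemma cocycle_bracket:
  assumes q: "\<And>g h. g \<in> carrier G \<Longrightarrow> h \<in> carrier G \<Longrightarrow> q (g \<otimes> h) = q g + fps_exp (lam g) * q h"
    and lam: "\<And>g h. g \<in> carrier G \<Longrightarrow> h \<in> carrier G \<Longrightarrow> lam (g \<otimes> h) = lam g + lam h"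
    and l: "\<And>v. v \<in> V \<Longrightarrow> lam (\<iota> v) = l v" and t: "\<And>v. v \<in> V \<Longrightarrow> fps_nth (q (\<iota> v)) 0 = t v"
  shows "bracket V \<iota> (\<lambda>k. fps_nth (fps_X ^ m * A * q k + B * (fps_exp (lam k) - 1)) (m + Suc (length xs)))
      (xs @ [a, b]) = fps_nth A 0 * prod_list (map (lin l) xs) * (lin l a * lin t b - lin t a * lin l b)"
proof -
  have lam1: "lam \<one> = 0" using lam[of \<one> \<one>] by simp
  have q1: "q \<one> = 0" using q[of \<one> \<one>] lam1 by simp
  let ?F = "\<lambda>A B k. A * q k + B * (fps_exp (lam k) - 1)"
  have diff: "?F A B (g \<otimes> k) - ?F A B (k \<otimes> g) = ?F (A * (fps_exp (lam g) - 1)) (- A * q g) k"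
    if "g \<in> carrier G" "k \<in> carrier G" for A B g k
    using that by (simp add: q lam fps_exp_add_mult algebra_simps)
  obtain U where U: "\<And>g. fps_exp (lam g) - 1 = fps_X * U g" "\<And>g. fps_nth (U g) 0 = lam g"
    using choice[of "\<lambda>g U. fps_exp (lam g) - 1 = fps_X * U \<and> fps_nth U 0 = lam g"]
      fps_exp_minus_1 by blast
  have bd: "bracket_diff (\<iota> v) (\<lambda>k. fps_nth (?F (fps_X ^ m * A) B k) n) k
      = fps_nth (?F (fps_X ^ Suc m * (A * U (\<iota> v))) (- (fps_X ^ m * A) * q (\<iota> v)) k) n"
    if "v \<in> V" "k \<in> carrier G" for v m A B n k
    using arg_cong[OF diff[OF \<iota>_carrier[OF that(1)] that(2), of "fps_X ^ m * A" B], of "\<lambda>F. fps_nth F n"]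
    unfolding bracket_diff_def fps_sub_nth[symmetric] by (simp add: U(1) mult_ac)
  show ?thesis
  proof (induction xs arbitrary: m A B)
    case Nil
    have "bracket_diff (\<iota> v) (\<lambda>k. fps_nth (?F (fps_X ^ m * A) B k) (Suc m)) (\<iota> w)
        = fps_nth A 0 * (l v * t w - t v * l w)" if "v \<in> V" "w \<in> V" for v w
    proof -
      have "?F (fps_X ^ Suc m * (A * U (\<iota> v))) (- (fps_X ^ m * A) * q (\<iota> v)) (\<iota> w)
          = fps_X ^ Suc m * (A * (U (\<iota> v) * q (\<iota> w) - q (\<iota> v) * U (\<iota> w)))"
        unfolding U(1) by (simp add: algebra_simps)
      with bd[OF that(1) \<iota>_carrier[OF that(2)], of m A B "Suc m"]
      have "bracket_diff (\<iota> v) (\<lambda>k. fps_nth (?F (fps_X ^ m * A) B k) (Suc m)) (\<iota> w)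
          = fps_nth (fps_X ^ Suc m * (A * (U (\<iota> v) * q (\<iota> w) - q (\<iota> v) * U (\<iota> w)))) (Suc m)"
        by (simp only:)
      also have "\<dots> = fps_nth (A * (U (\<iota> v) * q (\<iota> w) - q (\<iota> v) * U (\<iota> w))) 0"
        by (simp only: fps_X_power_mult_nth) simp
      finally show ?thesis using that by (simp add: U(2) l t)
    qed
    moreover have "bracket_diff (\<iota> v) (\<lambda>k. fps_nth (?F (fps_X ^ m * A) B k) (Suc m)) \<one> = 0"
      if "v \<in> V" for v
      using \<iota>_carrier[OF that] by (simp add: bracket_diff_def)
    ultimately have "bracket V \<iota> (\<lambda>k. fps_nth (?F (fps_X ^ m * A) B k) (Suc m)) [a, b]
        = (\<Sum>v\<in>V. a v * (\<Sum>w\<in>V. b w * (fps_nth A 0 * (l v * t w - t v * l w))))"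
      by simp
    also have "\<dots> = fps_nth A 0 * (lin l a * lin t b - lin t a * lin l b)"
    proof -
      have "lin l a * lin t b - lin t a * lin l b
          = (\<Sum>v\<in>V. \<Sum>w\<in>V. (a v * l v) * (b w * t w) - (a v * t v) * (b w * l w))"
        by (simp only: lin_def sum_product sum_subtractf)
      then show ?thesis by (simp add: sum_distrib_left algebra_simps)
    qed
    finally show ?case by simp
  next
    case (Cons x xs)
    have ne: "xs @ [a, b] \<noteq> []" by simp
    have "bracket V \<iota> (bracket_diff (\<iota> v)
          (\<lambda>k. fps_nth (?F (fps_X ^ m * A) B k) (m + Suc (length (x # xs))))) (xs @ [a, b])
        = fps_nth (A * U (\<iota> v)) 0 * prod_list (map (lin l) xs) * (lin l a * lin t b - lin t a * lin l b)"
      if v: "v \<in> V" for v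
    proof -
      have "bracket V \<iota> (bracket_diff (\<iota> v)
          (\<lambda>k. fps_nth (?F (fps_X ^ m * A) B k) (m + Suc (length (x # xs))))) (xs @ [a, b])
        = bracket V \<iota> (\<lambda>k. fps_nth (?F (fps_X ^ Suc m * (A * U (\<iota> v))) (- (fps_X ^ m * A) * q (\<iota> v)) k)
            (Suc m + Suc (length xs))) (xs @ [a, b])"
        using bd[OF v, of _ m A B "m + Suc (length (x # xs))"] by (intro bracket_cong \<iota>_image) simp
      also have "\<dots> = fps_nth (A * U (\<iota> v)) 0 * prod_list (map (lin l) xs) * (lin l a * lin t b - lin t a * lin l b)"
        by (rule Cons.IH)
      finally show ?thesis .
    qed
    then show ?case
      unfolding append_Cons bracket_Cons[OF ne]
      by (simp add: U(2) l lin_def[of l x] sum_distrib_left sum_distrib_right mult_ac cong: sum.cong)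
  qed
qed

section \<open>The action on the abelianisation\<close>

text \<open>The vanishing of the bracket of x and y in degree two of the Lie algebra, the exterior
  square modulo the edges.\<close>

definition comm :: "('v \<Rightarrow> complex) \<Rightarrow> ('v \<Rightarrow> complex) \<Rightarrow> bool" where
  "comm x y \<longleftrightarrow> (\<forall>u\<in>V. \<forall>v\<in>V. u \<noteq> v \<longrightarrow> \<not> adj u v \<longrightarrow> x u * y v = x v * y u)"

lemma commI:
  "(\<And>u v. u \<in> V \<Longrightarrow> v \<in> V \<Longrightarrow> u \<noteq> v \<Longrightarrow> \<not> adj u v \<Longrightarrow> x u * y v = x v * y u) \<Longrightarrow> comm x y"
  unfolding comm_def by blast

lemma commD:
  "comm x y \<Longrightarrow> u \<in> V \<Longrightarrow> v \<in> V \<Longrightarrow> u \<noteq> v \<Longrightarrow> \<not> adj u v \<Longrightarrow> x u * y v = x v * y u"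
  unfolding comm_def by blast

definition unit :: "'v \<Rightarrow> 'v \<Rightarrow> complex" where
  "unit w = (\<lambda>v. if v = w then 1 else 0)"

definition twins :: "'v \<Rightarrow> 'v \<Rightarrow> bool" where
  "twins u v \<longleftrightarrow> u \<in> V \<and> v \<in> V \<and> (\<forall>z\<in>V. z \<noteq> u \<longrightarrow> z \<noteq> v \<longrightarrow> (adj u z \<longleftrightarrow> adj v z))"

lemma twins_refl: "v \<in> V \<Longrightarrow> twins v v"
  by (simp add: twins_def)

lemma twins_sym: "twins u v \<Longrightarrow> twins v u"
  by (auto simp: twins_def)

lemma twins_trans:
  assumes uv: "twins u v" and vw: "twins v w"
  shows "twins u w"
proof -
  have "adj u z \<longleftrightarrow> adj w z" if z: "z \<in> V" "z \<noteq> u" "z \<noteq> w" for z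
  \<comment> \<open>At z = v neither twin relation applies directly; both are used on the pair u, w
    instead.\<close>
  proof (cases "z = v \<and> u \<noteq> w")
    case True
    then have "adj u w \<longleftrightarrow> adj v w" "adj v u \<longleftrightarrow> adj w u"
      using uv vw z unfolding twins_def by metis+
    then show ?thesis using True adj_sym by metis
  next
    case False
    then show ?thesis using uv vw z unfolding twins_def by metis
  qed
  then show ?thesis using uv vw unfolding twins_def by auto
qed

lemma act_unit: "w \<in> V \<Longrightarrow> act \<phi> (unit w) v = of_int (\<chi> v (\<phi> (\<iota> w)))"
  using finite_V by (simp add: act_def unit_def if_distrib[of "(*) _"] cong: if_cong)

lemma act_lincomb:
  "act \<phi> (\<lambda>v. a * x v + b * y v) w = a * act \<phi> x w + b * act \<phi> y w"
  by (simp add: act_def sum_distrib_left sum.distrib algebra_simps)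

lemma act_sum:
  "act \<phi> (\<lambda>v. \<Sum>i\<in>I. c i * y i v) w = (\<Sum>i\<in>I. c i * act \<phi> (y i) w)"
proof (induction I rule: infinite_finite_induct)
  case (insert i I)
  then show ?case using act_lincomb[of \<phi> "c i" "y i" 1 "\<lambda>v. \<Sum>i\<in>I. c i * y i v" w] by simp
qed (simp_all add: act_def)

lemma act_cong: "(\<And>v. v \<in> V \<Longrightarrow> x v = y v) \<Longrightarrow> act \<phi> x = act \<phi> y"
  by (auto simp: act_def intro!: ext sum.cong)

lemma coordinates_comp:
  assumes \<phi>: "\<phi> \<in> hom G G" and g: "g \<in> carrier G" and u: "u \<in> V"
  shows "\<chi> u (\<phi> g) = (\<Sum>v\<in>V. \<chi> u (\<phi> (\<iota> v)) * \<chi> v g)"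
proof -
  have "complex_of_int (\<chi> u (\<phi> g)) = (\<Sum>v\<in>V. of_int (\<chi> v g) * of_int (\<chi> u (\<phi> (\<iota> v))))"
    using \<phi> u by (intro additive_expand[OF _ g]) (auto simp: hom_mult hom_in_carrier \<chi>_mult)
  also have "\<dots> = of_int (\<Sum>v\<in>V. \<chi> u (\<phi> (\<iota> v)) * \<chi> v g)"
    by (simp add: mult.commute)
  finally show ?thesis by (simp only: of_int_eq_iff)
qed

lemma coordinates_inverse:
  assumes \<phi>: "\<phi> \<in> hom G G" and \<psi>: "\<psi> \<in> hom G G"
    and inv: "\<And>g. g \<in> carrier G \<Longrightarrow> \<psi> (\<phi> g) = g" and u: "u \<in> V" and w: "w \<in> V"
  shows "(\<Sum>v\<in>V. \<chi> u (\<psi> (\<iota> v)) * \<chi> v (\<phi> (\<iota> w))) = (if u = w then 1 else 0)"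
  using coordinates_comp[OF \<psi> hom_in_carrier[OF \<phi> \<iota>_carrier[OF w]] u] inv[OF \<iota>_carrier[OF w]]
    \<chi>_\<iota>[OF w u] by auto

lemma act_inverse:
  assumes \<phi>: "\<phi> \<in> hom G G" and \<psi>: "\<psi> \<in> hom G G"
    and inv: "\<And>g. g \<in> carrier G \<Longrightarrow> \<psi> (\<phi> g) = g" and u: "u \<in> V"
  shows "act \<psi> (act \<phi> x) u = x u"
proof -
  have "act \<psi> (act \<phi> x) u
      = (\<Sum>v\<in>V. \<Sum>w\<in>V. of_int (\<chi> u (\<psi> (\<iota> v)) * \<chi> v (\<phi> (\<iota> w))) * x w)"
    by (simp add: act_def sum_distrib_left mult_ac)
  also have "\<dots> = (\<Sum>w\<in>V. \<Sum>v\<in>V. of_int (\<chi> u (\<psi> (\<iota> v)) * \<chi> v (\<phi> (\<iota> w))) * x w)"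
    by (rule sum.swap)
  also have "\<dots> = (\<Sum>w\<in>V. of_int (\<Sum>v\<in>V. \<chi> u (\<psi> (\<iota> v)) * \<chi> v (\<phi> (\<iota> w))) * x w)"
    by (simp only: of_int_sum sum_distrib_right)
  also have "\<dots> = (\<Sum>w\<in>V. if u = w then x w else 0)"
    using coordinates_inverse[OF assms(1-4)] by (intro sum.cong) auto
  finally show ?thesis using u finite_V by simp
qed

lemma comm_lincomb:
  assumes "comm x y" "comm x z"
  shows "comm x (\<lambda>v. a * y v + b * z v)"
proof (rule commI)
  fix u v assume "u \<in> V" "v \<in> V" "u \<noteq> v" "\<not> adj u v"
  then have "x u * y v = x v * y u" "x u * z v = x v * z u"
    using assms by (blast dest: commD)+
  then show "x u * (a * y v + b * z v) = x v * (a * y u + b * z u)"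
    by (simp add: distrib_left mult.left_commute[of _ a] mult.left_commute[of _ b])
qed

lemma comm_sum: "(\<And>i. i \<in> I \<Longrightarrow> comm x (y i)) \<Longrightarrow> comm x (\<lambda>v. \<Sum>i\<in>I. c i * y i v)"
proof (induction I rule: infinite_finite_induct)
  case (insert i I)
  then show ?case using comm_lincomb[of x "y i" "\<lambda>v. \<Sum>i\<in>I. c i * y i v" "c i" 1] by simp
qed (simp_all add: commI)

lemma comm_cong:
  assumes "\<And>v. v \<in> V \<Longrightarrow> y v = z v" "comm x y"
  shows "comm x z"
  using commD[OF assms(2)] by (intro commI) (simp flip: assms(1))

text \<open>
  For non-adjacent \<open>a, b\<close> the Heisenberg quotient on \<open>a, b\<close> detects the coordinates
  \<open>\<chi> a g \<chi> b h - \<chi> a h \<chi> b g\<close> of a commutator.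
\<close>

lemma coordinates_of_commuting:
  assumes ab: "a \<in> V" "b \<in> V" "a \<noteq> b" "\<not> adj a b"
    and g: "g \<in> carrier G" and h: "h \<in> carrier G" and gh: "g \<otimes> h = h \<otimes> g"
  shows "\<chi> a g * \<chi> b h = \<chi> a h * \<chi> b g"
proof -
  have "unit a v * unit b w = unit a w * unit b v" if "adj v w" for v w
    using that ab(4) adj_sym adj_irrefl by (auto simp: unit_def)
  from cocycle_exists[of "unit a" "unit b", OF this] obtain q where
    q: "\<And>g h. g \<in> carrier G \<Longrightarrow> h \<in> carrier G \<Longrightarrow>
        q (g \<otimes> h) = q g + fps_exp (\<Sum>v\<in>V. unit a v * complex_of_int (\<chi> v g)) * q h"
    and t: "\<And>v. v \<in> V \<Longrightarrow> fps_nth (q (\<iota> v)) 0 = unit b v"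
    by blast
  have un: "(\<Sum>v\<in>V. unit a v * complex_of_int (\<chi> v g)) = of_int (\<chi> a g)" for g
    using ab(1) finite_V by (simp add: unit_def if_distrib[of "\<lambda>x. x * _"] cong: if_cong)
  have q0: "fps_nth (q g) 0 = of_int (\<chi> b g)" if "g \<in> carrier G" for g
  proof -
    have "fps_nth (q g) 0 = (\<Sum>w\<in>V. of_int (\<chi> w g) * fps_nth (q (\<iota> w)) 0)"
      using q by (intro additive_expand[OF _ that]) simp
    also have "\<dots> = (\<Sum>w\<in>V. if w = b then of_int (\<chi> w g) else 0)"
      using t by (intro sum.cong) (auto simp: unit_def)
    finally show ?thesis using ab(2) finite_V by simp
  qed
  have "fps_nth (q (g \<otimes> h)) 1 = fps_nth (q g) 1 + fps_nth (q h) 1 + of_int (\<chi> a g) * of_int (\<chi> b h)"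
    if "g \<in> carrier G" "h \<in> carrier G" for g h
    using that q[OF that] q0 by (simp add: un fps_mult_nth_1)
  from this[OF g h] this[OF h g] gh
  have "complex_of_int (\<chi> a g * \<chi> b h) = of_int (\<chi> a h * \<chi> b g)" by simp
  then show ?thesis by (simp only: of_int_eq_iff)
qed

text \<open>\<phi> carries adjacent generators to commuting elements, so its matrix respects the
  relations in degree two.\<close>

lemma comm_act:
  assumes \<phi>: "\<phi> \<in> hom G G" and xy: "comm x y"
  shows "comm (act \<phi> x) (act \<phi> y)"
proof (rule commI)
  fix a b assume ab: "a \<in> V" "b \<in> V" "a \<noteq> b" "\<not> adj a b"
  let ?M = "\<lambda>a v. complex_of_int (\<chi> a (\<phi> (\<iota> v)))"
  define D where "D = (\<lambda>v w. ?M a v * ?M b w - ?M b v * ?M a w)"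
  have "act \<phi> x a * act \<phi> y b - act \<phi> x b * act \<phi> y a
      = (\<Sum>v\<in>V. \<Sum>w\<in>V. (?M a v * x v) * (?M b w * y w) - (?M b v * x v) * (?M a w * y w))"
    by (simp only: act_def sum_product sum_subtractf)
  also have "\<dots> = (\<Sum>v\<in>V. \<Sum>w\<in>V. x v * (y w * D v w))"
    by (simp add: D_def algebra_simps)
  \<comment> \<open>With c = 0 the comparison lemma becomes a vanishing statement, as all minors of
    x and y at non-adjacent pairs are 0.\<close>
  also have "\<dots> = 0 * (\<Sum>v\<in>V. \<Sum>w\<in>V. x v * (y w * D v w))"
  proof (rule alternating_sum_eq[OF finite_V, where adj = adj])
    fix v w assume vw: "v \<in> V" "w \<in> V" "adj v w"
    have "\<phi> (\<iota> v) \<otimes> \<phi> (\<iota> w) = \<phi> (\<iota> w) \<otimes> \<phi> (\<iota> v)"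
      using adj_commute[OF vw] \<phi> \<iota>_carrier vw by (simp flip: hom_mult)
    then have "\<chi> a (\<phi> (\<iota> v)) * \<chi> b (\<phi> (\<iota> w)) = \<chi> a (\<phi> (\<iota> w)) * \<chi> b (\<phi> (\<iota> v))"
      using \<phi> \<iota>_carrier vw by (intro coordinates_of_commuting ab) (auto simp: hom_in_carrier)
    then have "?M a v * ?M b w = ?M a w * ?M b v"
      by (metis of_int_mult)
    then show "D v w = 0" by (simp add: D_def mult.commute)
  next
    fix u v assume "u \<in> V" "v \<in> V" "u \<noteq> v" "\<not> adj u v"
    then show "x u * y v - x v * y u = 0 * (x u * y v - x v * y u)"
      using commD[OF xy, of u v] by simp
  qed (simp add: D_def mult.commute)
  finally show "act \<phi> x a * act \<phi> y b = act \<phi> x b * act \<phi> y a" by simp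
qed

text \<open>
  If \<open>x\<close> is supported in the twin class of \<open>c\<close>, then \<open>x\<close> commutes with the \<open>k\<close> neighbours of \<open>c\<close>. Modulo
  \<open>y = act \<phi> x\<close> their images are supported on the \<open>k\<close> neighbours of any \<open>s\<close> in the support of \<open>y\<close>, so
  by counting they span, and every neighbour of \<open>s\<close> commutes with \<open>y\<close>.
\<close>

lemma act_support_twins:
  assumes \<phi>: "\<phi> \<in> hom G G" and \<psi>: "\<psi> \<in> hom G G"
    and inv: "\<And>g. g \<in> carrier G \<Longrightarrow> \<psi> (\<phi> g) = g"
    and reg: "\<And>v. v \<in> V \<Longrightarrow> card {z\<in>V. adj v z} = k"
    and supp: "\<And>u v. u \<in> V \<Longrightarrow> v \<in> V \<Longrightarrow> x u \<noteq> 0 \<Longrightarrow> x v \<noteq> 0 \<Longrightarrow> twins u v"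
    and s: "s \<in> V" "act \<phi> x s \<noteq> 0" and t: "t \<in> V" "act \<phi> x t \<noteq> 0"
  shows "twins s t"
proof -
  let ?y = "act \<phi> x"
  obtain c where c: "c \<in> V" "x c \<noteq> 0"
    using s(2) unfolding act_def by (metis (no_types, lifting) mult_eq_0_iff sum.neutral)
  let ?W = "{z\<in>V. adj c z}"
  have comm_x: "comm x (unit w)" if w: "w \<in> ?W" for w
  proof (rule commI)
    have *: "adj a w" if "a \<in> V" "x a \<noteq> 0" "a \<noteq> w" for a
      using supp[OF c(1) that(1) c(2) that(2)] w that adj_irrefl unfolding twins_def by auto
    fix a b assume ab: "a \<in> V" "b \<in> V" "a \<noteq> b" "\<not> adj a b"
    then show "x a * unit w b = x b * unit w a"
      using *[of a] *[of b] adj_sym by (auto simp: unit_def)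
  qed
  have nbr: "adj s u \<Longrightarrow> comm ?y (unit u)" if s: "s \<in> V" "?y s \<noteq> 0" and u: "u \<in> V" for s u
  proof -
    assume su: "adj s u"
    \<comment> \<open>The multiple of \<open>?y\<close> that has to be subtracted to make the image
      of w vanish at s; commuting with \<open>?y\<close> then forces it to vanish off the neighbours
      of s.\<close>
    define \<kappa> where "\<kappa> = (\<lambda>w. act \<phi> (unit w) s / ?y s)"
    define y' where "y' = (\<lambda>w z. 1 * act \<phi> (unit w) z + (- \<kappa> w) * ?y z)"
    have comm_y': "comm ?y (y' w)" if "w \<in> ?W" for w
      unfolding y'_def
      by (intro comm_lincomb comm_act[OF \<phi> comm_x[OF that]] commI) (rule mult.commute)
    have y'_s: "y' w s = 0" for w using s by (simp add: y'_def \<kappa>_def)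
    have y'_off: "y' w z = 0" if w: "w \<in> ?W" and z: "z \<in> V" "\<not> adj s z" for w z
    proof (cases "z = s")
      case False
      then have "?y s * y' w z = ?y z * y' w s"
        using commD[OF comm_y'[OF w]] s z by blast
      then show ?thesis using y'_s s by simp
    qed (simp add: y'_s)
    define h where "h = (\<lambda>i z. case i of None \<Rightarrow> unit u z | Some w \<Rightarrow> y' w z)"
    let ?I = "insert None (Some ` ?W)"
    have finW: "finite ?W" using finite_V by simp
    \<comment> \<open>These are k + 1 vectors, \<open>unit u\<close> and the k images, on k
      coordinates.\<close>
    have "card {z\<in>V. adj s z} < card ?I"
      using reg[OF s(1)] reg[OF c(1)] finW by (simp add: card_image)
    then obtain d where d: "\<exists>i\<in>?I. d i \<noteq> 0" "\<And>z. z \<in> V \<Longrightarrow> adj s z \<Longrightarrow> (\<Sum>i\<in>?I. d i * h i z) = 0"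
      using finite_dependence[of "{z\<in>V. adj s z}" ?I h] finite_V by auto
    have sum_I: "(\<Sum>i\<in>?I. d i * h i z) = d None * unit u z + (\<Sum>w\<in>?W. d (Some w) * y' w z)" for z
      using finW by (simp add: h_def sum.reindex)
    have rel: "d None * unit u z + (\<Sum>w\<in>?W. d (Some w) * y' w z) = 0" if z: "z \<in> V" for z
    proof (cases "adj s z")
      case True
      then show ?thesis using d(2)[OF z] unfolding sum_I by blast
    next
      case False
      then have "(\<Sum>w\<in>?W. d (Some w) * y' w z) = 0"
        using y'_off[OF _ z] by (intro sum.neutral) auto
      then show ?thesis using False su by (auto simp: unit_def)
    qed
    \<comment> \<open>Otherwise \<open>act \<phi>\<close> kills a combination of x and neighbours of
      c. By injectivity the combination is 0; at c only x contributes, so \<kappa>' = 0, and then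
      all coefficients vanish.\<close>
    have dN: "d None \<noteq> 0"
    proof
      assume dN: "d None = 0"
      define \<kappa>' where "\<kappa>' = (\<Sum>w\<in>?W. d (Some w) * \<kappa> w)"
      define e where "e = (\<lambda>v. 1 * (\<Sum>w\<in>?W. d (Some w) * unit w v) + (- \<kappa>') * x v)"
      have "act \<phi> e z = 0" if z: "z \<in> V" for z
      proof -
        have "act \<phi> e z = (\<Sum>w\<in>?W. d (Some w) * act \<phi> (unit w) z) - \<kappa>' * ?y z"
          unfolding e_def act_lincomb act_sum by simp
        also have "\<dots> = (\<Sum>w\<in>?W. d (Some w) * y' w z)"
          by (simp add: y'_def \<kappa>'_def sum_distrib_left sum_distrib_right sum_subtractf algebra_simps)
        finally show ?thesis using rel[OF z] dN by simp
      qed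
      then have "act \<psi> (act \<phi> e) v = 0" for v by (simp add: act_def)
      then have e0: "e v = 0" if "v \<in> V" for v
        using act_inverse[OF \<phi> \<psi> inv that, of e] by simp
      have sum_unit: "(\<Sum>w\<in>?W. d (Some w) * unit w v) = (if v \<in> ?W then d (Some v) else 0)" for v
        using finW by (simp add: unit_def if_distrib[of "(*) _"] cong: if_cong)
      have "\<kappa>' = 0" using e0[OF c(1)] c adj_irrefl by (simp add: e_def sum_unit)
      then have "d (Some w) = 0" if "w \<in> ?W" for w
        using e0[of w] that by (simp add: e_def sum_unit)
      with dN d(1) show False by auto
    qed
    have "unit u z = (\<Sum>w\<in>?W. (- d (Some w) / d None) * y' w z)" if z: "z \<in> V" for z
    proof -
      have "d None * unit u z = - (\<Sum>w\<in>?W. d (Some w) * y' w z)"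
        using rel[OF z] by (simp add: add_eq_0_iff)
      then have "unit u z = - (\<Sum>w\<in>?W. d (Some w) * y' w z) / d None"
        using dN by (simp add: field_simps)
      then show ?thesis by (simp add: sum_divide_distrib sum_negf)
    qed
    moreover have "comm ?y (\<lambda>z. \<Sum>w\<in>?W. (- d (Some w) / d None) * y' w z)"
      by (rule comm_sum[OF comm_y'])
    ultimately show "comm ?y (unit u)" by (auto elim: comm_cong[rotated])
  qed
  have "adj t z" if s: "s \<in> V" "?y s \<noteq> 0" and t: "t \<in> V" "?y t \<noteq> 0"
    and z: "z \<in> V" "z \<noteq> t" "adj s z" for s t z
  proof (rule ccontr)
    assume "\<not> adj t z"
    then have "?y t * unit z z = ?y z * unit z t"
      using commD[OF nbr[OF s z(1,3)]] t(1) z by blast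
    then show False using t(2) z(2) by (auto simp: unit_def split: if_splits)
  qed
  then show ?thesis using s t unfolding twins_def by blast
qed

section \<open>Minimal invariant sets and the supports of eigenvectors\<close>

definition invariant_set :: "('a \<Rightarrow> 'a) \<Rightarrow> ('a \<Rightarrow> 'a) \<Rightarrow> 'v set \<Rightarrow> bool" where
  "invariant_set \<phi> \<psi> U \<longleftrightarrow> U \<subseteq> V \<and> (\<forall>u v. twins u v \<longrightarrow> u \<in> U \<longrightarrow> v \<in> U) \<and>
     (\<forall>v\<in>U. \<forall>w\<in>V. \<chi> w (\<phi> (\<iota> v)) \<noteq> 0 \<longrightarrow> w \<in> U) \<and>
     (\<forall>v\<in>U. \<forall>w\<in>V. \<chi> w (\<psi> (\<iota> v)) \<noteq> 0 \<longrightarrow> w \<in> U) \<and>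
     (\<exists>u\<in>U. \<exists>v\<in>U. u \<noteq> v \<and> \<not> adj u v)"

text \<open>If x were nonzero on the class to which \<phi> sends v, the eigenvector equation would
  give some v' outside the zero set of x that is sent to the same class. Applying \<psi> then makes
  v and v' twins.\<close>

lemma eigenvector_vanishing_closed:
  assumes \<phi>: "\<phi> \<in> hom G G" and \<psi>: "\<psi> \<in> hom G G"
    and inv: "\<And>g. g \<in> carrier G \<Longrightarrow> \<psi> (\<phi> g) = g" "\<And>g. g \<in> carrier G \<Longrightarrow> \<phi> (\<psi> g) = g"
    and reg: "\<And>v. v \<in> V \<Longrightarrow> card {z\<in>V. adj v z} = k"
    and eig: "\<And>w. w \<in> V \<Longrightarrow> act \<phi> x w = \<alpha> * x w" "\<alpha> \<noteq> 0"
    and v: "v \<in> V" "\<And>v'. twins v v' \<Longrightarrow> x v' = 0"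
    and w: "w \<in> V" "\<chi> w (\<phi> (\<iota> v)) \<noteq> 0" and w': "twins w w'"
  shows "x w' = 0"
proof (rule ccontr)
  assume xw': "x w' \<noteq> 0"
  have w'V: "w' \<in> V" using w' by (simp add: twins_def)
  have "act \<phi> x w' \<noteq> 0" using eig w'V xw' by simp
  then obtain v' where "v' \<in> V" "of_int (\<chi> w' (\<phi> (\<iota> v'))) * x v' \<noteq> 0"
    unfolding act_def by (rule sum.not_neutral_contains_not_neutral)
  then have v': "v' \<in> V" "\<chi> w' (\<phi> (\<iota> v')) \<noteq> 0" "x v' \<noteq> 0" by auto
  \<comment> \<open>A sum without cancellation, nonzero at v and at v' even if they
    coincide.\<close>
  define e where "e = (\<lambda>z. 1 * unit v z + 1 * unit v' z)"
  have cls: "twins c z" if "u \<in> V" "c \<in> V" "\<chi> c (\<phi> (\<iota> u)) \<noteq> 0" "z \<in> V" "act \<phi> (unit u) z \<noteq> 0" for u c z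
  proof (rule act_support_twins[OF \<phi> \<psi> inv(1) reg])
    show "twins a b" if "a \<in> V" "b \<in> V" "unit u a \<noteq> 0" "unit u b \<noteq> 0" for a b
      using that twins_refl by (auto simp: unit_def split: if_splits)
  qed (use that act_unit in auto)
  have cls_w: "twins w z" if "z \<in> V" "act \<phi> e z \<noteq> 0" for z
  proof -
    have "act \<phi> (unit v) z \<noteq> 0 \<or> act \<phi> (unit v') z \<noteq> 0"
      using that(2) unfolding e_def act_lincomb by auto
    then show ?thesis
      using cls[OF v(1) w that(1)] cls[OF v'(1) w'V v'(2) that(1)] twins_trans[OF w'] by blast
  qed
  have ee: "act \<psi> (act \<phi> e) z = e z" if "z \<in> V" for z
    using act_inverse[OF \<phi> \<psi> inv(1) that] .
  have "twins v v'"
  proof (rule act_support_twins[OF \<psi> \<phi> inv(2) reg])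
    show "twins a b" if "a \<in> V" "b \<in> V" "act \<phi> e a \<noteq> 0" "act \<phi> e b \<noteq> 0" for a b
      using cls_w that twins_trans twins_sym by blast
    show "act \<psi> (act \<phi> e) v \<noteq> 0" "act \<psi> (act \<phi> e) v' \<noteq> 0"
      using ee v(1) v'(1) by (auto simp: e_def unit_def)
  qed (use v v' in auto)
  with v(2) v'(3) show False by blast
qed

text \<open>The twin classes in U on which x vanishes would form an invariant set containing u and
  v, hence all of U by minimality, although x is nonzero at \<open>z0\<close>.\<close>

lemma eigenvector_nonvanishing:
  assumes \<phi>: "\<phi> \<in> hom G G" and \<psi>: "\<psi> \<in> hom G G"
    and inv: "\<And>g. g \<in> carrier G \<Longrightarrow> \<psi> (\<phi> g) = g" "\<And>g. g \<in> carrier G \<Longrightarrow> \<phi> (\<psi> g) = g"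
    and reg: "\<And>v. v \<in> V \<Longrightarrow> card {z\<in>V. adj v z} = k"
    and U: "invariant_set \<phi> \<psi> U" and min: "\<And>Z. invariant_set \<phi> \<psi> Z \<Longrightarrow> card U \<le> card Z"
    and eig: "\<And>w. w \<in> V \<Longrightarrow> act \<phi> x w = \<alpha> * x w"
    and x: "z0 \<in> U" "x z0 \<noteq> 0"
    and uv: "u \<in> U" "v \<in> U" "u \<noteq> v" "\<not> adj u v"
  shows "\<exists>z. (twins u z \<or> twins v z) \<and> x z \<noteq> 0"
proof (rule ccontr)
  assume contra: "\<not> (\<exists>z. (twins u z \<or> twins v z) \<and> x z \<noteq> 0)"
  have UV: "U \<subseteq> V" using U by (simp add: invariant_set_def)
  have scale: "act \<psi> (act \<phi> x) w = \<alpha> * act \<psi> x w" for w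
  proof -
    have "act \<psi> (act \<phi> x) = act \<psi> (\<lambda>v. \<alpha> * x v + 0 * x v)"
      by (rule act_cong) (simp add: eig)
    then show ?thesis by (simp only: act_lincomb) simp
  qed
  have x_scale: "x w = \<alpha> * act \<psi> x w" if "w \<in> V" for w
    using act_inverse[OF \<phi> \<psi> inv(1) that, of x] scale[of w] by simp
  \<comment> \<open>With \<alpha> nonzero, x is also an eigenvector of \<psi>, so closure of the
    zero set follows for both maps.\<close>
  then have \<alpha>: "\<alpha> \<noteq> 0" using x UV by auto
  have eig': "act \<psi> x w = inverse \<alpha> * x w" if "w \<in> V" for w
    using x_scale[OF that] \<alpha> by (simp add: field_simps)
  define Z where "Z = {z\<in>U. \<forall>z'. twins z z' \<longrightarrow> x z' = 0}"
  have "invariant_set \<phi> \<psi> Z"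
    unfolding invariant_set_def
  proof (intro conjI allI ballI impI)
    show "Z \<subseteq> V" using UV by (auto simp: Z_def)
    show "b \<in> Z" if "twins a b" "a \<in> Z" for a b
      using that U twins_trans[OF that(1)] unfolding Z_def invariant_set_def by blast
    show "w \<in> Z" if a: "a \<in> Z" and w: "w \<in> V" "\<chi> w (\<phi> (\<iota> a)) \<noteq> 0" for a w
    proof -
      have aV: "a \<in> V" and az: "\<And>a'. twins a a' \<Longrightarrow> x a' = 0" using a UV by (auto simp: Z_def)
      have wU: "w \<in> U" using a w U unfolding Z_def invariant_set_def by blast
      have "x w' = 0" if "twins w w'" for w'
        by (rule eigenvector_vanishing_closed[OF \<phi> \<psi> inv reg eig \<alpha> aV az w that])
      with wU show ?thesis unfolding Z_def by blast
    qed
    show "w \<in> Z" if a: "a \<in> Z" and w: "w \<in> V" "\<chi> w (\<psi> (\<iota> a)) \<noteq> 0" for a w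
    proof -
      have aV: "a \<in> V" and az: "\<And>a'. twins a a' \<Longrightarrow> x a' = 0" using a UV by (auto simp: Z_def)
      have "inverse \<alpha> \<noteq> 0" using \<alpha> by simp
      have wU: "w \<in> U" using a w U unfolding Z_def invariant_set_def by blast
      have "x w' = 0" if "twins w w'" for w'
        by (rule eigenvector_vanishing_closed[OF \<psi> \<phi> inv(2,1) reg eig' \<open>inverse \<alpha> \<noteq> 0\<close> aV az w that])
      with wU show ?thesis unfolding Z_def by blast
    qed
    show "\<exists>u\<in>Z. \<exists>v\<in>Z. u \<noteq> v \<and> \<not> adj u v"
      using contra uv unfolding Z_def by blast
  qed
  then have "card U \<le> card Z" by (rule min)
  moreover have "finite U" using UV finite_V by (rule finite_subset)
  ultimately have "Z = U" by (intro card_seteq) (auto simp: Z_def)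
  then have "x z0 = 0" using x(1) UV twins_refl[of z0] unfolding Z_def by blast
  with x(2) show False by contradiction
qed

text \<open>
  Take \<open>l\<close> generic on the twin classes of \<open>u\<close> and \<open>v\<close>, and \<open>t\<close> its restriction to \<open>v\<close> if \<open>u, v\<close> are
  twins, and to the class of \<open>v\<close> otherwise.
\<close>

lemma generic_functionals:
  assumes uv: "u \<in> V" "v \<in> V" "u \<noteq> v" "\<not> adj u v"
    and wedge: "e u * b v \<noteq> e v * b u"
    and X: "\<And>a. a \<in> set as \<Longrightarrow> \<exists>z. (twins u z \<or> twins v z) \<and> X a z \<noteq> 0"
  shows "\<exists>l t. (\<forall>p\<in>V. \<forall>r\<in>V. adj p r \<longrightarrow> l p * t r = l r * t p) \<and>
    prod_list (map (\<lambda>a. lin l (X a)) as) \<noteq> 0 \<and> lin l e * lin t b - lin t e * lin l b \<noteq> 0"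
proof -
  define D where "D = {z. twins u z \<or> twins v z}"
  define W where "W = (if twins u v then {v} else {z. twins v z})"
  have WD: "W \<subseteq> D" and DV: "D \<subseteq> V"
    using uv twins_refl by (auto simp: D_def W_def twins_def)
  have uD: "u \<in> D" and vW: "v \<in> W" and uW: "u \<notin> W"
    using uv twins_refl by (auto simp: D_def W_def dest: twins_sym)
  have no_edge: "\<not> adj p r" if p: "p \<in> D" "p \<notin> W" and r: "r \<in> W" for p r
  proof (cases "twins u v")
    case True
    then have "r = v" "p \<noteq> v" "twins u p"
      using p r twins_trans[OF True] by (auto simp: D_def W_def)
    then show ?thesis using uv unfolding twins_def by (cases "p = u") metis+
  next
    case False
    then have up: "twins u p" and vr: "twins v r" and "\<not> twins v p"
      using p r by (auto simp: D_def W_def)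
    have "\<not> twins u r" using False vr twins_trans twins_sym by blast
    then have ne: "r \<noteq> u" "r \<noteq> p" "u \<noteq> v"
      using up uv twins_refl by auto
    have "r \<in> V" using vr by (simp add: twins_def)
    then have "adj u r \<longleftrightarrow> adj p r" using up ne unfolding twins_def by metis
    moreover have "adj v u \<longleftrightarrow> adj r u" using vr ne uv unfolding twins_def by metis
    ultimately show ?thesis using uv adj_sym by blast
  qed
  define l where "l = (\<lambda>m z. if z \<in> D then m z else (0::complex))"
  define t where "t = (\<lambda>m z. if z \<in> W then m z else (0::complex))"
  have adm: "l m p * t m r = l m r * t m p" if "adj p r" for m p r
    using no_edge[of p r] no_edge[of r p] that adj_sym[OF that] WD by (auto simp: l_def t_def)
  have lin_l: "lin (l m) y = (\<Sum>z\<in>D. y z * m z)" for m y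
    unfolding lin_def l_def using DV finite_V by (intro sum.mono_neutral_cong_right) auto
  have lin_t: "lin (t m) y = (\<Sum>z\<in>W. y z * m z)" for m y
    unfolding lin_def t_def using WD DV finite_V by (intro sum.mono_neutral_cong_right) auto
  have finD: "finite D" using DV finite_V by (rule finite_subset)
  then have finW: "finite W" by (rule finite_subset[OF WD])
  have F: "line_poly (\<lambda>m. lin (l m) (X a)) \<and> (\<exists>m. lin (l m) (X a) \<noteq> 0)" if a: "a \<in> set as" for a
  proof
    show "line_poly (\<lambda>m. lin (l m) (X a))" unfolding lin_l by (rule line_poly_linear)
    obtain z where z: "z \<in> D" "X a z \<noteq> 0" using X[OF a] by (auto simp: D_def)
    then have "lin (l (unit z)) (X a) = X a z"
      using finD by (simp add: lin_l unit_def if_distrib[of "(*) _"] cong: if_cong)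
    then show "\<exists>m. lin (l m) (X a) \<noteq> 0" using z by metis
  qed
  let ?Q = "\<lambda>m. lin (l m) e * lin (t m) b - lin (t m) e * lin (l m) b"
  have Q: "line_poly ?Q"
    unfolding lin_l lin_t
    by (rule line_poly_diff[OF line_poly_mult[OF line_poly_linear[of e D] line_poly_linear[of b W]]
          line_poly_mult[OF line_poly_linear[of e W] line_poly_linear[of b D]]])
  \<comment> \<open>At this point \<open>?Q\<close> is exactly the minor of e and b at u, v.\<close>
  define m0 where "m0 = (\<lambda>z. unit u z + unit v z)"
  have "lin (l m0) y = y u + y v" for y
    using finD uD vW WD uv(3)
    by (auto simp: lin_l m0_def unit_def distrib_left sum.distrib if_distrib[of "(*) _"] cong: if_cong)
  moreover have "lin (t m0) y = y v" for y
    using finW uW vW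
    by (auto simp: lin_t m0_def unit_def distrib_left sum.distrib if_distrib[of "(*) _"] cong: if_cong)
  ultimately have "?Q m0 \<noteq> 0" using wedge by (simp add: algebra_simps)
  from line_poly_prod_nonzero[of "as" "\<lambda>a m. lin (l m) (X a)", OF F]
  obtain m1 where P: "line_poly (\<lambda>m. prod_list (map (\<lambda>a. lin (l m) (X a)) as))"
    "prod_list (map (\<lambda>a. lin (l m1) (X a)) as) \<noteq> 0" by blast
  from line_poly_common_nonzero[where H = ?Q and l = m1 and m = m0, OF P Q \<open>?Q m0 \<noteq> 0\<close>] obtain m where
    "prod_list (map (\<lambda>a. lin (l m) (X a)) as) * ?Q m \<noteq> 0" by blast
  then show ?thesis using adm by (intro exI[of _ "l m"] exI[of _ "t m"]) auto
qed

theorem fixed_poly_fun_regular: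
  assumes \<phi>: "\<phi> \<in> hom G G" and \<psi>: "\<psi> \<in> hom G G"
    and inv: "\<And>g. g \<in> carrier G \<Longrightarrow> \<psi> (\<phi> g) = g" "\<And>g. g \<in> carrier G \<Longrightarrow> \<phi> (\<psi> g) = g"
    and reg: "\<And>v. v \<in> V \<Longrightarrow> card {z\<in>V. adj v z} = k"
    and nonadj: "\<exists>u\<in>V. \<exists>v\<in>V. u \<noteq> v \<and> \<not> adj u v"
  shows "\<exists>d h. fixed_poly_fun \<phi> d h"
proof -
  have "invariant_set \<phi> \<psi> V" using nonadj by (auto simp: invariant_set_def twins_def)
  then obtain U where U: "invariant_set \<phi> \<psi> U" and min: "\<And>Z. invariant_set \<phi> \<psi> Z \<Longrightarrow> card U \<le> card Z"
    using ex_has_least_nat[of "invariant_set \<phi> \<psi>" V card] by blast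
  have nonvanishing: "\<exists>z. (twins u z \<or> twins v z) \<and> x z \<noteq> 0"
    if "\<And>w. w \<in> V \<Longrightarrow> act \<phi> x w = a * x w" "z0 \<in> U" "x z0 \<noteq> 0" "u \<in> U" "v \<in> U" "u \<noteq> v" "\<not> adj u v"
    for x a z0 u v
    by (rule eigenvector_nonvanishing[OF \<phi> \<psi> inv reg U min that])
  have UV: "U \<subseteq> V" and U_twins: "\<And>u v. twins u v \<Longrightarrow> u \<in> U \<Longrightarrow> v \<in> U"
    and U\<phi>: "\<And>v w. v \<in> U \<Longrightarrow> w \<in> V \<Longrightarrow> \<chi> w (\<phi> (\<iota> v)) \<noteq> 0 \<Longrightarrow> w \<in> U"
    and U\<psi>: "\<And>v w. v \<in> U \<Longrightarrow> w \<in> V \<Longrightarrow> \<chi> w (\<psi> (\<iota> v)) \<noteq> 0 \<Longrightarrow> w \<in> U"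
    using U unfolding invariant_set_def by blast+
  obtain u0 v0 where uv0: "u0 \<in> U" "v0 \<in> U" "u0 \<noteq> v0" "\<not> adj u0 v0"
    using U unfolding invariant_set_def by blast
  have finU: "finite U" using UV finite_V by (rule finite_subset)
  let ?M = "\<lambda>w v. \<chi> w (\<phi> (\<iota> v))" and ?N = "\<lambda>w v. \<chi> w (\<psi> (\<iota> v))"
  have "(\<Sum>v\<in>U. ?M u v * ?N v w) = (if u = w then 1 else 0)" if uw: "u \<in> U" "w \<in> U" for u w
  proof -
    \<comment> \<open>Closure of U under \<psi> allows restricting the sum to U, so the matrix on U
      is invertible over the integers.\<close>
    have "(\<Sum>v\<in>U. ?M u v * ?N v w) = (\<Sum>v\<in>V. ?M u v * ?N v w)"
      using UV U\<psi>[OF uw(2)] finite_V by (intro sum.mono_neutral_left) auto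
    also have "\<dots> = (if u = w then 1 else 0)"
      using uw UV by (intro coordinates_inverse[OF \<psi> \<phi> inv(2)]) auto
    finally show ?thesis .
  qed
  then have MN: "\<forall>u\<in>U. \<forall>w\<in>U. (\<Sum>v\<in>U. ?M u v * ?N v w) = (if u = w then 1 else 0)" by blast
  obtain es :: "complex list" and P :: "nat \<Rightarrow> 'v \<Rightarrow> complex" where es: "length es = card U" "prod_list es ^ 2 = 1"
    and eigen: "\<And>a. a \<in> set es \<Longrightarrow> \<exists>x. (\<exists>v\<in>U. x v \<noteq> 0) \<and> (\<forall>v. v \<notin> U \<longrightarrow> x v = 0) \<and>
       (\<forall>w\<in>U. (\<Sum>v\<in>U. of_int (?M w v) * x v) = a * x w)"
    and P0: "\<And>j v. j < card U \<Longrightarrow> v \<notin> U \<Longrightarrow> P j v = 0"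
    and Ptri: "\<And>j. j < card U \<Longrightarrow> \<exists>c. \<forall>w\<in>U.
       (\<Sum>v\<in>U. of_int (?M w v) * P j v) = es ! j * P j w + (\<Sum>i<j. c i * P i w)"
    and Pspan: "\<And>y. \<exists>c. \<forall>w\<in>U. y w = (\<Sum>j<card U. c j * P j w)"
  proof -
    show thesis by (rule integer_matrix_triangular[OF finU MN that])
  qed
  have act_U: "act \<phi> x w = (if w \<in> U then \<Sum>v\<in>U. of_int (?M w v) * x v else 0)"
    if x: "\<And>v. v \<notin> U \<Longrightarrow> x v = 0" and w: "w \<in> V" for x w
  proof -
    have "act \<phi> x w = (\<Sum>v\<in>U. of_int (?M w v) * x v)"
      unfolding act_def using UV finite_V x by (intro sum.mono_neutral_right) auto
    moreover have "(\<Sum>v\<in>U. of_int (?M w v) * x v) = 0" if "w \<notin> U"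
      using U\<phi> w that by (intro sum.neutral) auto
    ultimately show ?thesis by simp
  qed
  have "\<exists>x. (\<exists>v\<in>U. x v \<noteq> 0) \<and> (\<forall>v. v \<notin> U \<longrightarrow> x v = 0) \<and> (\<forall>w\<in>V. act \<phi> x w = a * x w)"
    if a: "a \<in> set es" for a
  proof -
    obtain x where x: "\<exists>v\<in>U. x v \<noteq> 0" "\<And>v. v \<notin> U \<Longrightarrow> x v = 0"
      "\<And>w. w \<in> U \<Longrightarrow> (\<Sum>v\<in>U. of_int (?M w v) * x v) = a * x w"
      using eigen[OF a] by blast
    have "act \<phi> x w = a * x w" if "w \<in> V" for w
      using act_U[OF x(2) that] x(2,3) by simp
    with x(1,2) show ?thesis by blast
  qed
  then have "\<forall>a\<in>set es. \<exists>x. (\<exists>v\<in>U. x v \<noteq> 0) \<and> (\<forall>v. v \<notin> U \<longrightarrow> x v = 0) \<and> (\<forall>w\<in>V. act \<phi> x w = a * x w)"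
    by blast
  from bchoice[OF this] obtain X where X: "\<And>a. a \<in> set es \<Longrightarrow> \<exists>v\<in>U. X a v \<noteq> 0"
    "\<And>a v. a \<in> set es \<Longrightarrow> v \<notin> U \<Longrightarrow> X a v = 0"
    "\<And>a w. a \<in> set es \<Longrightarrow> w \<in> V \<Longrightarrow> act \<phi> (X a) w = a * X a w" by blast
  have X_nonvanishing: "\<exists>z. (twins u z \<or> twins v z) \<and> X a z \<noteq> 0"
    if "a \<in> set es" "u \<in> U" "v \<in> U" "u \<noteq> v" "\<not> adj u v" for a u v
  proof -
    obtain z0 where "z0 \<in> U" "X a z0 \<noteq> 0" using X(1) \<open>a \<in> set es\<close> by blast
    then show ?thesis by (intro nonvanishing[of "X a" a z0] X(3)[OF that(1)] that(2-5))
  qed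
  have "es \<noteq> []" using es(1) uv0 finU by auto
  then obtain \<alpha> where \<alpha>: "\<alpha> \<in> set es" by (cases es) auto
  define e where "e = X \<alpha>"
  have "\<exists>w\<in>U. \<not> comm e (unit w)"
  proof -
    \<comment> \<open>If z differs from r, it inherits non-adjacency to r from its twin p, so
      \<open>unit r\<close> fails to commute with e; if z = r, then \<open>unit p\<close>
      does.\<close>
    have *: ?thesis if zs: "twins p z" "e z \<noteq> 0" and pr: "p \<in> U" "r \<in> U" "p \<noteq> r" "\<not> adj p r" for p r z
    proof (cases "z = r")
      case False
      have V: "z \<in> V" "r \<in> V" using zs pr UV by (auto simp: twins_def)
      have "\<not> adj z r" using zs(1) pr False V unfolding twins_def by metis
      then have "\<not> comm e (unit r)"
        using commD[of e "unit r" z r] V False zs(2) by (auto simp: unit_def)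
      then show ?thesis using pr by blast
    next
      case True
      have V: "p \<in> V" "r \<in> V" using pr UV by auto
      have "\<not> comm e (unit p)"
        using commD[of e "unit p" r p] V True zs(2) pr adj_sym by (auto simp: unit_def)
      then show ?thesis using pr by blast
    qed
    have vu0: "\<not> adj v0 u0" "v0 \<noteq> u0" using uv0 adj_sym by auto
    show ?thesis
      using X_nonvanishing[OF \<alpha> uv0] *[of u0 _ v0] *[of v0 _ u0] uv0 vu0 unfolding e_def by blast
  qed
  then obtain w where w: "w \<in> U" "\<not> comm e (unit w)" by blast
  have "\<exists>j<card U. \<not> comm e (P j)"
  proof (rule ccontr)
    assume "\<not> ?thesis"
    then have "comm e (P j)" if "j < card U" for j using that by blast
    obtain c where c: "\<And>z. z \<in> U \<Longrightarrow> unit w z = (\<Sum>j<card U. c j * P j z)"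
      using Pspan[of "unit w"] by blast
    have "comm e (\<lambda>z. \<Sum>j<card U. c j * P j z)"
      using \<open>\<And>j. j < card U \<Longrightarrow> comm e (P j)\<close> by (intro comm_sum) simp
    moreover have "(\<Sum>j<card U. c j * P j z) = unit w z" if "z \<in> V" for z
    proof (cases "z \<in> U")
      case False
      then have "z \<noteq> w" using w by auto
      then show ?thesis using P0[OF _ False] by (simp add: unit_def)
    qed (simp add: c)
    ultimately have "comm e (unit w)" by (rule comm_cong[rotated])
    with w(2) show False by contradiction
  qed
  \<comment> \<open>By the choice of j, all lower terms of the triangular relation for
    \<open>P j\<close> commute with e.\<close>
  then obtain j where j: "j < card U" "\<not> comm e (P j)" and least: "\<And>i. i < j \<Longrightarrow> comm e (P i)"
    using exists_least_iff[of "\<lambda>j. j < card U \<and> \<not> comm e (P j)"] by (metis less_trans)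
  define b where "b = P j"
  define \<gamma> where "\<gamma> = es ! j"
  have \<gamma>: "\<gamma> \<in> set es" using j(1) es(1) by (simp add: \<gamma>_def)
  obtain c where c: "\<And>w. w \<in> U \<Longrightarrow>
      (\<Sum>v\<in>U. of_int (?M w v) * b v) = \<gamma> * b w + (\<Sum>i<j. c i * P i w)"
    using Ptri[OF j(1)] unfolding b_def \<gamma>_def by blast
  define y where "y = (\<lambda>w. \<Sum>i<j. c i * P i w)"
  have comm_y: "comm e y" unfolding y_def using least by (intro comm_sum) simp
  have b0: "b z = 0" if "z \<notin> U" for z using P0[OF j(1) that] by (simp add: b_def)
  have act_b: "act \<phi> b w = \<gamma> * b w + y w" if "w \<in> V" for w
  proof (cases "w \<in> U")
    case True
    then show ?thesis using act_U[OF b0 that] c by (simp add: y_def)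
  next
    case False
    have "y w = 0" using P0[OF _ False] j(1) by (simp add: y_def)
    then show ?thesis using act_U[OF b0 that] False b0[OF False] by simp
  qed
  have act_e: "act \<phi> e w = \<alpha> * e w" if "w \<in> V" for w
    unfolding e_def by (rule X(3)[OF \<alpha> that])
  \<comment> \<open>Modulo vectors commuting with e, b behaves like an eigenvector for
    \<gamma>.\<close>
  have wedge: "act \<phi> e u * act \<phi> b v - act \<phi> e v * act \<phi> b u = (\<alpha> * \<gamma>) * (e u * b v - e v * b u)"
    if "u \<in> V" "v \<in> V" "u \<noteq> v" "\<not> adj u v" for u v
    using commD[OF comm_y that] by (simp add: act_e act_b that algebra_simps)
  obtain u v where uv: "u \<in> V" "v \<in> V" "u \<noteq> v" "\<not> adj u v" and eb: "e u * b v \<noteq> e v * b u"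
    using j(2) unfolding comm_def b_def by blast
  have e0: "e z = 0" if "z \<notin> U" for z using X(2)[OF \<alpha> that] by (simp add: e_def)
  have uvU: "u \<in> U" "v \<in> U" using eb e0 b0 by (metis mult_zero_left mult_zero_right)+
  \<comment> \<open>The entries e and b use up one \<alpha> and one \<gamma>. Doubling the list
    removes the sign of the determinant and also leaves a \<gamma> to remove when \<gamma> =
    \<alpha>.\<close>
  define as where "as = remove1 \<gamma> (remove1 \<alpha> (es @ es))"
  have as_es: "set as \<subseteq> set es"
    using set_remove1_subset[of \<gamma> "remove1 \<alpha> (es @ es)"] set_remove1_subset[of \<alpha> "es @ es"]
    by (auto simp: as_def)
  have "\<gamma> \<in> set (remove1 \<alpha> (es @ es))"
    using \<gamma> \<alpha> by (simp add: remove1_append)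
  then have "prod_list (es @ es) = \<alpha> * (\<gamma> * prod_list as)"
    using prod_list_remove1[of \<alpha> "es @ es"] prod_list_remove1[of \<gamma> "remove1 \<alpha> (es @ es)"] \<alpha>
    by (simp add: as_def)
  then have prod_as: "prod_list as * (\<alpha> * \<gamma>) = 1"
    using es(2) by (simp add: power2_eq_square mult_ac)
  have "\<And>a. a \<in> set as \<Longrightarrow> \<exists>z. (twins u z \<or> twins v z) \<and> X a z \<noteq> 0"
    using X_nonvanishing[OF _ uvU uv(3,4)] as_es by blast
  from generic_functionals[where X = X and as = "as", OF uv eb this] obtain l t where
    adm: "\<And>p r. p \<in> V \<Longrightarrow> r \<in> V \<Longrightarrow> adj p r \<Longrightarrow> l p * t r = l r * t p"
    and nz: "prod_list (map (\<lambda>a. lin l (X a)) as) \<noteq> 0" "lin l e * lin t b - lin t e * lin l b \<noteq> 0"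
    by blast
  define lam where "lam = (\<lambda>g. \<Sum>v\<in>V. l v * complex_of_int (\<chi> v g))"
  obtain q where q: "\<And>g h. g \<in> carrier G \<Longrightarrow> h \<in> carrier G \<Longrightarrow> q (g \<otimes> h) = q g + fps_exp (lam g) * q h"
    and qt: "\<And>v. v \<in> V \<Longrightarrow> fps_nth (q (\<iota> v)) 0 = t v"
    using cocycle_exists[of l t, OF adm] unfolding lam_def by blast
  have lam: "lam (g \<otimes> h) = lam g + lam h" if "g \<in> carrier G" "h \<in> carrier G" for g h
    using that by (simp add: lam_def \<chi>_mult sum.distrib distrib_left)
  have lam_\<iota>: "lam (\<iota> v) = l v" if v: "v \<in> V" for v
  proof -
    have "lam (\<iota> v) = (\<Sum>w\<in>V. if v = w then l w else 0)"
      unfolding lam_def using \<chi>_\<iota>[OF v] by (intro sum.cong) auto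
    then show ?thesis using v finite_V by simp
  qed
  \<comment> \<open>The bracket has \<open>length as + 2\<close> = d + 1 entries, and the d-th
    coefficient of q has degree d + 1.\<close>
  define d where "d = Suc (length as)"
  define f where "f = (\<lambda>g. fps_nth (q g) d)"
  have f: "poly_fun (Suc d) f"
  proof -
    have "poly_fun (Suc d) (\<lambda>k. fps_nth (1 * q k) d)"
      by (rule cocycle_poly_fun(2)[of q lam]) (simp_all only: q lam)
    then show ?thesis by (simp only: f_def mult_1)
  qed
  let ?\<theta> = "\<lambda>h. bracket V \<iota> h (map X as @ [e, b])"
  have "\<exists>h. fixed_poly_fun \<phi> d h"
  proof (rule fixed_poly_fun_exists[OF _ \<iota>_image generate_\<iota> \<phi> f, of ?\<theta>])
    show "finite (\<iota> ` V)" using finite_V by simp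
    show "?\<theta> (\<lambda>x. a * h x + b * g x) = a * ?\<theta> h + b * ?\<theta> g" for a b h g
      by (rule bracket_lincomb)
    show "?\<theta> h = 0" if "poly_fun (Suc d) h" "\<And>x. x \<in> poly_ker d \<Longrightarrow> h x = h \<one>" for h
      using that by (intro bracket_const_poly_ker[OF \<iota>_image]) (auto simp: d_def)
    show "?\<theta> (\<lambda>x. h (\<phi> x)) = ?\<theta> h" if h: "poly_fun (Suc d) h" for h
    proof -
      have "?\<theta> (\<lambda>x. h (\<phi> x)) = bracket V \<iota> h (map (act \<phi>) (map X as @ [e, b]))"
        by (rule bracket_hom[OF \<phi> h]) (simp add: d_def)
      also have "\<dots> = bracket V \<iota> h (map (\<lambda>a. act \<phi> (X a)) as @ [act \<phi> e, act \<phi> b])"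
        by (simp add: comp_def)
      also have "\<dots> = prod_list as * bracket V \<iota> h (map X as @ [act \<phi> e, act \<phi> b])"
        using X(3) as_es by (intro bracket_append_scale) auto
      also have "bracket V \<iota> h (map X as @ [act \<phi> e, act \<phi> b])
          = (\<alpha> * \<gamma>) * bracket V \<iota> h (map X as @ [e, b])"
        by (rule bracket_append_wedge[OF wedge])
      finally show ?thesis using prod_as by (simp flip: mult.assoc)
    qed
    have "?\<theta> f = prod_list (map (lin l) (map X as)) * (lin l e * lin t b - lin t e * lin l b)"
    proof -
      have "bracket V \<iota> (\<lambda>k. fps_nth (fps_X ^ 0 * 1 * q k + 0 * (fps_exp (lam k) - 1))
          (0 + Suc (length (map X as)))) (map X as @ [e, b])
        = fps_nth 1 0 * prod_list (map (lin l) (map X as)) * (lin l e * lin t b - lin t e * lin l b)"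
        by (rule cocycle_bracket) (simp_all only: q lam lam_\<iota> qt)
      then show ?thesis by (simp add: f_def d_def)
    qed
    then show "?\<theta> f \<noteq> 0" using nz by (simp add: comp_def)
  qed
  then show ?thesis by blast
qed

end

section \<open>Homomorphisms from groups given by generators and relators\<close>

definition word_eval :: "('b, 'c) monoid_scheme \<Rightarrow> ('a \<Rightarrow> 'b) \<Rightarrow> 'a word \<Rightarrow> 'b" where
  "word_eval H f u = foldr (\<lambda>(s, b) y. (if b then f s else inv\<^bsub>H\<^esub> f s) \<otimes>\<^bsub>H\<^esub> y) u \<one>\<^bsub>H\<^esub>"

text \<open>The homomorphism of von Dyck's theorem. The chosen representative is immaterial by
  \<open>pres_rel_word_eval\<close> when f respects the relators.\<close>

definition presented_lift ::
  "('b, 'c) monoid_scheme \<Rightarrow> ('a \<Rightarrow> 'b) \<Rightarrow> 'a word set \<Rightarrow> 'b" where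
  "presented_lift H f X = word_eval H f (SOME u. u \<in> X)"

context group
begin

lemma word_eval_closed:
  assumes f: "f \<in> S \<rightarrow> carrier G"
  shows "u \<in> words S \<Longrightarrow> word_eval G f u \<in> carrier G"
proof (induction u)
  case (Cons x u)
  obtain s b where x: "x = (s, b)" by (cases x)
  have "s \<in> S" "u \<in> words S" using Cons.prems by (auto simp: words_def x)
  moreover from this(1) have "f s \<in> carrier G" using f by auto
  ultimately show ?case using Cons.IH by (simp add: word_eval_def x)
qed (simp add: word_eval_def)

lemma word_eval_append:
  assumes f: "f \<in> S \<rightarrow> carrier G" and v: "v \<in> words S"
  shows "u \<in> words S \<Longrightarrow> word_eval G f (u @ v) = word_eval G f u \<otimes> word_eval G f v"
proof (induction u)
  case Nil
  then show ?case using word_eval_closed[OF f v] by (simp add: word_eval_def)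
next
  case (Cons x u)
  obtain s b where x: "x = (s, b)" by (cases x)
  have s: "s \<in> S" and u: "u \<in> words S" using Cons.prems by (auto simp: words_def x)
  let ?g = "if b then f s else inv f s"
  have g: "?g \<in> carrier G" using f s by auto
  have ev: "word_eval G f ((s, b) # w) = ?g \<otimes> word_eval G f w" for w
    by (simp add: word_eval_def)
  show ?case
    using Cons.IH[OF u] g word_eval_closed[OF f u] word_eval_closed[OF f v]
    unfolding x append_Cons ev by (simp only: m_assoc)
qed

lemma pres_rel_word_eval:
  assumes f: "f \<in> S \<rightarrow> carrier G"
    and R: "\<And>r. r \<in> R \<Longrightarrow> r \<in> words S \<Longrightarrow> word_eval G f r = \<one>"
  shows "(u, v) \<in> pres_rel S R \<Longrightarrow> word_eval G f u = word_eval G f v"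
proof (induction rule: pres_rel.induct)
  case (append u u' v v')
  have "u \<in> words S" "u' \<in> words S" "v \<in> words S" "v' \<in> words S"
    using pres_rel_words append.hyps by blast+
  then show ?case using append.IH by (simp add: word_eval_append[OF f])
next
  case (cancel s b)
  then have "f s \<in> carrier G" using f by auto
  then show ?case by (cases b) (simp_all add: word_eval_def)
next
  case (relator r)
  then show ?case using R[of r] by (simp add: word_eval_def)
qed auto

lemma presented_lift_class:
  assumes f: "f \<in> S \<rightarrow> carrier G"
    and R: "\<And>r. r \<in> R \<Longrightarrow> r \<in> words S \<Longrightarrow> word_eval G f r = \<one>" and u: "u \<in> words S"
  shows "presented_lift G f (pres_rel S R `` {u}) = word_eval G f u"
proof -
  have "u \<in> pres_rel S R `` {u}" using pres_rel.refl[OF u] by auto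
  then have "(SOME v. v \<in> pres_rel S R `` {u}) \<in> pres_rel S R `` {u}" by (rule someI)
  then have "(u, SOME v. v \<in> pres_rel S R `` {u}) \<in> pres_rel S R" by blast
  with f R have "word_eval G f u = word_eval G f (SOME v. v \<in> pres_rel S R `` {u})"
    by (rule pres_rel_word_eval)
  then show ?thesis by (simp only: presented_lift_def)
qed

lemma presented_lift_hom:
  assumes f: "f \<in> S \<rightarrow> carrier G"
    and R: "\<And>r. r \<in> R \<Longrightarrow> r \<in> words S \<Longrightarrow> word_eval G f r = \<one>"
  shows "presented_lift G f \<in> hom (presented_group S R) G"
proof (rule homI)
  have cls: "\<exists>u\<in>words S. X = pres_rel S R `` {u}" if "X \<in> carrier (presented_group S R)" for X
    using that by (auto simp: presented_group_def quotient_def)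
  note lift = presented_lift_class[OF f R]
  show "presented_lift G f X \<in> carrier G" if "X \<in> carrier (presented_group S R)" for X
    using cls[OF that] lift word_eval_closed[OF f] by auto
  show "presented_lift G f (X \<otimes>\<^bsub>presented_group S R\<^esub> Y)
      = presented_lift G f X \<otimes> presented_lift G f Y"
    if XY: "X \<in> carrier (presented_group S R)" "Y \<in> carrier (presented_group S R)" for X Y
  proof -
    obtain u v where u: "u \<in> words S" "X = pres_rel S R `` {u}"
      and v: "v \<in> words S" "Y = pres_rel S R `` {v}"
      using cls[OF XY(1)] cls[OF XY(2)] by blast
    have "u @ v \<in> words S" using u(1) v(1) by (simp add: words_def)
    then show ?thesis
      unfolding u(2) v(2) presented_group_mult_class[OF u(1) v(1)]
      using lift u(1) v(1) word_eval_append[OF f v(1) u(1)] by simp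
  qed
qed

lemma word_eval_commutator:
  assumes "f v \<in> carrier G" "f w \<in> carrier G" "f v \<otimes> f w = f w \<otimes> f v"
  shows "word_eval G f (commutator_word v w) = \<one>"
proof -
  have "f v \<otimes> f w \<otimes> (inv f v \<otimes> inv f w) = f w \<otimes> f v \<otimes> inv (f w \<otimes> f v)"
    using assms by (simp add: inv_mult_group)
  then have "f v \<otimes> f w \<otimes> (inv f v \<otimes> inv f w) = \<one>"
    using assms(1,2) by simp
  then show ?thesis
    using assms(1,2) by (simp add: word_eval_def commutator_word_def m_assoc)
qed

end

lemma presented_group_generate:
  "generate (presented_group S R) ((\<lambda>s. pres_rel S R `` {[(s, True)]}) ` S)
    = carrier (presented_group S R)"
proof -
  let ?P = "presented_group S R" and ?c = "\<lambda>u. pres_rel S R `` {u}"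
  interpret P: group ?P by (rule group_presented_group)
  have car: "carrier ?P = ?c ` words S" by (auto simp: presented_group_def quotient_def)
  have one: "\<one>\<^bsub>?P\<^esub> = ?c []" by (simp add: presented_group_def)
  have letter: "[(s, b)] \<in> words S" if "s \<in> S" for s b using that by (simp add: words_def)
  let ?\<iota> = "\<lambda>s. ?c [(s, True)]"
  have "?c u \<in> generate ?P (?\<iota> ` S)" if "u \<in> words S" for u
    using that
  proof (induction u)
    case Nil
    show ?case unfolding one[symmetric] by (rule generate.one)
  next
    case (Cons x u)
    obtain s b where x: "x = (s, b)" by (cases x)
    have s: "s \<in> S" and u: "u \<in> words S" using Cons.prems by (auto simp: words_def x)
    have "?c [(s, b)] \<in> generate ?P (?\<iota> ` S)"
    proof (cases b)
      case True
      then show ?thesis using s by (auto intro: generate.incl)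
    next
      case False
      have "?c [(s, False)] \<otimes>\<^bsub>?P\<^esub> ?\<iota> s = \<one>\<^bsub>?P\<^esub>"
        unfolding presented_group_mult_class[OF letter[OF s] letter[OF s]] one
        using equiv_class_eq[OF equiv_pres_rel pres_rel.cancel[OF s, of False R]] by simp
      then have "inv\<^bsub>?P\<^esub> ?\<iota> s = ?c [(s, False)]"
        using letter[OF s] by (intro P.inv_equality) (auto simp: car)
      then show ?thesis using False s generate.inv[of "?\<iota> s" "?\<iota> ` S" ?P] by auto
    qed
    then have "?c [(s, b)] \<otimes>\<^bsub>?P\<^esub> ?c u \<in> generate ?P (?\<iota> ` S)"
      using Cons.IH[OF u] by (rule generate.eng)
    then show ?case unfolding presented_group_mult_class[OF letter[OF s] u] x by simp
  qed
  then have "carrier ?P \<subseteq> generate ?P (?\<iota> ` S)" unfolding car by (rule image_subsetI)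
  moreover have "?\<iota> ` S \<subseteq> carrier ?P" using letter by (auto simp: car)
  then have "generate ?P (?\<iota> ` S) \<subseteq> carrier ?P" using P.generate_in_carrier by (intro subsetI)
  ultimately show ?thesis by (intro equalityI)
qed

section \<open>Right-angled Artin groups\<close>

text \<open>The pair \<open>(a, q)\<close> is the affine map \<open>x \<mapsto> exp (a s) x + q\<close> of the power series in \<open>s\<close>.\<close>

definition affine_group :: "(complex \<times> complex fps) monoid" where
  "affine_group = \<lparr>carrier = UNIV,
     monoid.mult = (\<lambda>x y. (fst x + fst y, snd x + fps_exp (fst x) * snd y)), one = (0, 0)\<rparr>"

lemma group_affine_group: "group affine_group"
proof (rule groupI)
  fix x :: "complex \<times> complex fps"
  show "\<exists>y\<in>carrier affine_group. y \<otimes>\<^bsub>affine_group\<^esub> x = \<one>\<^bsub>affine_group\<^esub>"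
    by (rule bexI[of _ "(- fst x, - fps_exp (- fst x) * snd x)"]) (simp_all add: affine_group_def)
qed (simp_all add: affine_group_def fps_exp_add_mult algebra_simps)

lemma RAAG_coordinates:
  fixes \<Gamma> :: "'v pair_pre_digraph"
  assumes \<Gamma>: "pair_graph \<Gamma>"
  shows "\<exists>\<iota> \<chi>. raag_coordinates (RAAG \<Gamma>) (pverts \<Gamma>) \<iota> \<chi> (\<lambda>v w. (v, w) \<in> parcs \<Gamma>)"
proof -
  interpret pair_graph \<Gamma> by (rule \<Gamma>)
  let ?R = "{commutator_word v w | v w. (v, w) \<in> parcs \<Gamma>}"
  let ?V = "pverts \<Gamma>"
  have RAAG: "RAAG \<Gamma> = presented_group ?V ?R" by (simp add: RAAG_def)
  define \<iota> where "\<iota> = (\<lambda>v. pres_rel ?V ?R `` {[(v, True)]})"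
  define \<chi> where "\<chi> = (\<lambda>w :: 'v. presented_lift integer_group (\<lambda>v. if v = w then 1 else 0))"
  interpret Z: group integer_group by simp
  interpret A: group affine_group by (rule group_affine_group)
  have letter: "[(v, True)] \<in> words ?V" if "v \<in> ?V" for v using that by (simp add: words_def)
  have \<iota>_car: "\<iota> v \<in> carrier (RAAG \<Gamma>)" if "v \<in> ?V" for v
    using letter[OF that] by (auto simp: \<iota>_def RAAG presented_group_def intro: quotientI)
  have Zev: "word_eval integer_group f r = \<one>\<^bsub>integer_group\<^esub>" if "r \<in> ?R" for f :: "'v \<Rightarrow> int" and r
  proof -
    obtain v w where "r = commutator_word v w" using \<open>r \<in> ?R\<close> by blast
    then show ?thesis using Z.word_eval_commutator[of f v w] by (simp add: add.commute)
  qed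
  have \<chi>_hom: "\<chi> w \<in> hom (RAAG \<Gamma>) integer_group" for w
    unfolding \<chi>_def RAAG by (rule Z.presented_lift_hom) (use Zev in auto)
  have \<chi>_\<iota>: "\<chi> w (\<iota> v) = (if v = w then 1 else 0)" if "v \<in> ?V" for v w
  proof -
    have "\<chi> w (\<iota> v) = word_eval integer_group (\<lambda>v. if v = w then 1 else 0) [(v, True)]"
      unfolding \<chi>_def \<iota>_def by (rule Z.presented_lift_class) (use Zev letter[OF that] in auto)
    then show ?thesis by (simp add: word_eval_def)
  qed
  interpret coordinate_group "RAAG \<Gamma>" ?V \<iota> \<chi>
  proof (intro coordinate_group.intro coordinate_group_axioms.intro)
    show "group (RAAG \<Gamma>)" unfolding RAAG by (rule group_presented_group)
    show "generate (RAAG \<Gamma>) (\<iota> ` ?V) = carrier (RAAG \<Gamma>)"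
      unfolding RAAG \<iota>_def by (rule presented_group_generate)
    show "\<chi> w (g \<otimes>\<^bsub>RAAG \<Gamma>\<^esub> h) = \<chi> w g + \<chi> w h"
      if "g \<in> carrier (RAAG \<Gamma>)" "h \<in> carrier (RAAG \<Gamma>)" for w g h
      using hom_mult[OF \<chi>_hom that] by simp
  qed (use pair_finite_verts \<iota>_car \<chi>_\<iota> in auto)
  have "raag_coordinates_axioms (RAAG \<Gamma>) ?V \<iota> \<chi> (\<lambda>v w. (v, w) \<in> parcs \<Gamma>)"
  proof
    show "(w, v) \<in> parcs \<Gamma>" if "(v, w) \<in> parcs \<Gamma>" for v w
      using that by (rule arcs_symmetric)
    show "(v, v) \<notin> parcs \<Gamma>" for v using pair_no_loops by fastforce
    show "\<iota> v \<otimes>\<^bsub>RAAG \<Gamma>\<^esub> \<iota> w = \<iota> w \<otimes>\<^bsub>RAAG \<Gamma>\<^esub> \<iota> v"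
      if v: "v \<in> ?V" and w: "w \<in> ?V" and vw: "(v, w) \<in> parcs \<Gamma>" for v w
    proof -
      let ?r = "pres_rel ?V ?R"
      let ?u = "[(v, True), (w, True), (v, False), (w, False)]"
      have wd: "u \<in> words ?V" if "set u \<subseteq> {v, w} \<times> UNIV" for u
        using that v w by (auto simp: words_def)
      have "?u \<in> ?R" using vw unfolding commutator_word_def by blast
      then have "(?u, []) \<in> ?r" using wd[of ?u] by (intro pres_rel.relator) auto
      then have 1: "(?u @ [(w, True), (v, True)], [] @ [(w, True), (v, True)]) \<in> ?r"
        by (rule pres_rel.append) (use wd in \<open>auto intro: pres_rel.refl\<close>)
      have "([(w, False), (w, True)], []) \<in> ?r"
        using pres_rel.cancel[OF w, of False ?R] by simp
      from pres_rel.append[OF pres_rel.append[OF pres_rel.refl[of "[(v, False)]"] this]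
          pres_rel.refl[of "[(v, True)]"]]
      have "([(v, False), (w, False), (w, True), (v, True)], [(v, False), (v, True)]) \<in> ?r"
        using wd by auto
      moreover have "([(v, False), (v, True)], []) \<in> ?r"
        using pres_rel.cancel[OF v, of False ?R] by simp
      ultimately have "([(v, False), (w, False), (w, True), (v, True)], []) \<in> ?r"
        by (rule pres_rel.trans)
      from pres_rel.append[OF pres_rel.refl[of "[(v, True), (w, True)]"] this]
      have "(?u @ [(w, True), (v, True)], [(v, True), (w, True)]) \<in> ?r"
        using wd by auto
      from pres_rel.trans[OF pres_rel.sym[OF this] 1]
      have "([(v, True), (w, True)], [(w, True), (v, True)]) \<in> ?r" by simp
      from equiv_class_eq[OF equiv_pres_rel this] show ?thesis
        unfolding \<iota>_def RAAG using presented_group_mult_class[OF letter letter] v w by simp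
    qed
    fix l t :: "'v \<Rightarrow> complex"
    assume adm: "\<And>v w. v \<in> ?V \<Longrightarrow> w \<in> ?V \<Longrightarrow> (v, w) \<in> parcs \<Gamma> \<Longrightarrow> l v * t w = l w * t v"
    \<comment> \<open>The series of (exp(a s) - 1) / (a s), which makes sense also for a =
      0.\<close>
    define E :: "complex \<Rightarrow> complex fps" where "E = (\<lambda>a. Abs_fps (\<lambda>n. a ^ n / fact (Suc n)))"
    have E: "fps_exp a - 1 = fps_X * (fps_const a * E a)" for a
    proof (rule fps_ext)
      fix n show "fps_nth (fps_exp a - 1) n = fps_nth (fps_X * (fps_const a * E a)) n"
        by (cases n) (simp_all add: E_def del: fact_Suc)
    qed
    \<comment> \<open>The exponential of the infinitesimal affine map with linear part l(v) s and
      translation t(v). Its translation part has constant term t(v), and two such maps commute when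
      l(v) t(w) = l(w) t(v).\<close>
    define f where "f = (\<lambda>v. (l v, fps_const (t v) * E (l v)))"
    have comm: "f v \<otimes>\<^bsub>affine_group\<^esub> f w = f w \<otimes>\<^bsub>affine_group\<^esub> f v" if vw: "(v, w) \<in> parcs \<Gamma>" for v w
    proof -
      have "l v * t w = l w * t v" using adm[of v w] vw in_arcsD1 in_arcsD2 by blast
      then have lt: "fps_const (l v) * fps_const (t w) = fps_const (l w) * fps_const (t v)" by simp
      have "(fps_exp (l v) - 1) * (fps_const (t w) * E (l w))
          = (fps_const (l v) * fps_const (t w)) * (fps_X * E (l v) * E (l w))"
        unfolding E by (simp only: mult_ac)
      also have "\<dots> = (fps_exp (l w) - 1) * (fps_const (t v) * E (l v))"
        unfolding E lt by (simp only: mult_ac)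
      finally show ?thesis by (simp add: f_def affine_group_def algebra_simps)
    qed
    have Aev: "word_eval affine_group f r = \<one>\<^bsub>affine_group\<^esub>" if "r \<in> ?R" for r
    proof -
      obtain v w where r: "r = commutator_word v w" "(v, w) \<in> parcs \<Gamma>" using \<open>r \<in> ?R\<close> by blast
      have "f v \<in> carrier affine_group" "f w \<in> carrier affine_group" by (simp_all add: affine_group_def)
      then show ?thesis using comm[OF r(2)] unfolding r(1) by (rule A.word_eval_commutator)
    qed
    have f_car: "f \<in> ?V \<rightarrow> carrier affine_group" by (simp add: affine_group_def)
    define L where "L = presented_lift affine_group f"
    have L_hom: "L \<in> hom (RAAG \<Gamma>) affine_group"
      unfolding L_def RAAG by (rule A.presented_lift_hom[OF f_car]) (use Aev in auto)
    have L_mult: "fst (L (g \<otimes>\<^bsub>RAAG \<Gamma>\<^esub> h)) = fst (L g) + fst (L h)"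
      "snd (L (g \<otimes>\<^bsub>RAAG \<Gamma>\<^esub> h)) = snd (L g) + fps_exp (fst (L g)) * snd (L h)"
      if "g \<in> carrier (RAAG \<Gamma>)" "h \<in> carrier (RAAG \<Gamma>)" for g h
      using hom_mult[OF L_hom that] by (simp_all add: affine_group_def)
    have L_\<iota>: "L (\<iota> v) = f v" if "v \<in> ?V" for v
    proof -
      have "L (\<iota> v) = word_eval affine_group f [(v, True)]"
        unfolding L_def \<iota>_def by (rule A.presented_lift_class[OF f_car _ letter[OF that]]) (use Aev in auto)
      then show ?thesis by (simp add: word_eval_def affine_group_def)
    qed
    have "fst (L g) = (\<Sum>v\<in>?V. l v * complex_of_int (\<chi> v g))" if g: "g \<in> carrier (RAAG \<Gamma>)" for g
    proof -
      have "fst (L g) = (\<Sum>v\<in>?V. of_int (\<chi> v g) * fst (L (\<iota> v)))"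
        using L_mult(1) g by (rule additive_expand[where c = "\<lambda>g. fst (L g)"])
      then show ?thesis using L_\<iota> by (simp add: f_def mult.commute)
    qed
    then show "\<exists>q. (\<forall>g\<in>carrier (RAAG \<Gamma>). \<forall>h\<in>carrier (RAAG \<Gamma>).
        q (g \<otimes>\<^bsub>RAAG \<Gamma>\<^esub> h) = q g + fps_exp (\<Sum>v\<in>?V. l v * complex_of_int (\<chi> v g)) * q h) \<and>
        (\<forall>v\<in>?V. fps_nth (q (\<iota> v)) 0 = t v)"
      using L_mult(2) L_\<iota> by (intro exI[of _ "\<lambda>g. snd (L g)"]) (simp add: f_def E_def)
  qed
  then show ?thesis using raag_coordinates.intro coordinate_group_axioms by blast
qed

theorem theorem5p3p12:
  fixes \<Gamma> :: "'v pair_pre_digraph"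
  assumes "strongly_regular \<Gamma>"
  shows "R_infinity_property (RAAG \<Gamma>)"
proof -
  obtain n k where reg: "regular_graph \<Gamma> k" and n: "card (pverts \<Gamma>) = n" and k: "k < n - 1"
    using assms unfolding strongly_regular_def strongly_regular_with_def by blast
  have \<Gamma>: "pair_graph \<Gamma>" "pverts \<Gamma> \<noteq> {}" and lk: "\<And>v. v \<in> pverts \<Gamma> \<Longrightarrow> card (lk \<Gamma> v) = k"
    using reg by (auto simp: regular_graph_def simple_graph_def)
  interpret pair_graph \<Gamma> by (rule \<Gamma>(1))
  obtain \<iota> \<chi> where "raag_coordinates (RAAG \<Gamma>) (pverts \<Gamma>) \<iota> \<chi> (\<lambda>v w. (v, w) \<in> parcs \<Gamma>)"
    using RAAG_coordinates[OF \<Gamma>(1)] by blast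
  then interpret R: raag_coordinates "RAAG \<Gamma>" "pverts \<Gamma>" \<iota> \<chi> "\<lambda>v w. (v, w) \<in> parcs \<Gamma>" .
  have lk_eq: "lk \<Gamma> v = {z \<in> pverts \<Gamma>. (v, z) \<in> parcs \<Gamma>}" for v
    using in_arcsD2 by (auto simp: lk_def)
  have card_nbrs: "card {z \<in> pverts \<Gamma>. (v, z) \<in> parcs \<Gamma>} = k" if "v \<in> pverts \<Gamma>" for v
    using lk[OF that] by (simp add: lk_eq)
  have nonadj: "\<exists>u\<in>pverts \<Gamma>. \<exists>v\<in>pverts \<Gamma>. u \<noteq> v \<and> (u, v) \<notin> parcs \<Gamma>"
  proof -
    obtain u where u: "u \<in> pverts \<Gamma>" using \<Gamma>(2) by blast
    have "card (insert u (lk \<Gamma> u)) \<le> Suc k" using lk[OF u] card_insert_le_m1[of "Suc k" "lk \<Gamma> u" u] by simp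
    then have "card (insert u (lk \<Gamma> u)) < card (pverts \<Gamma>)" using k n by linarith
    then have "\<not> pverts \<Gamma> \<subseteq> insert u (lk \<Gamma> u)"
      using card_mono[of "insert u (lk \<Gamma> u)" "pverts \<Gamma>"] pair_finite_verts by (force simp: lk_eq)
    then obtain v where "v \<in> pverts \<Gamma>" "v \<noteq> u" "v \<notin> lk \<Gamma> u" by blast
    then show ?thesis using u by (intro bexI[of _ u] bexI[of _ v]) (auto simp: lk_def)
  qed
  show ?thesis
    unfolding R_infinity_property_def
  proof
    fix \<phi> assume \<phi>: "\<phi> \<in> auto (RAAG \<Gamma>)"
    then have hom: "\<phi> \<in> hom (RAAG \<Gamma>) (RAAG \<Gamma>)" and bij: "bij_betw \<phi> (carrier (RAAG \<Gamma>)) (carrier (RAAG \<Gamma>))"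
      by (auto simp: auto_def Bij_def)
    define \<psi> where "\<psi> = inv_into (carrier (RAAG \<Gamma>)) \<phi>"
    have \<psi>: "\<psi> \<in> hom (RAAG \<Gamma>) (RAAG \<Gamma>)"
    proof -
      have "\<phi> \<in> iso (RAAG \<Gamma>) (RAAG \<Gamma>)" using hom bij by (simp add: iso_def)
      from R.iso_set_sym[OF this] show ?thesis by (simp add: iso_def \<psi>_def)
    qed
    have "\<exists>d h. R.fixed_poly_fun \<phi> d h"
      using card_nbrs nonadj bij
      by (intro R.fixed_poly_fun_regular[OF hom \<psi>])
        (auto simp: \<psi>_def bij_betw_inv_into_left bij_betw_inv_into_right)
    then obtain d h where "R.fixed_poly_fun \<phi> d h" by blast
    then have "infinite (carrier (RAAG \<Gamma>) // twisted_conj (RAAG \<Gamma>) \<phi>)"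
      by (intro R.infinite_twisted_classes[OF _ R.\<iota>_image R.generate_\<iota> hom])
        (simp_all add: pair_finite_verts)
    then show "reidemeister_number (RAAG \<Gamma>) \<phi> = \<infinity>"
      by (simp add: reidemeister_number_def)
  qed
qed

end
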